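(* Let $\alpha,k$ be positive integers with $k\le\alpha$, let $\beta\in\mathbb{R}\setminus\{-1,-2,-3,\dots\}$, and let $a=(a_0,\dots,a_{k-1})\in\mathbb{R}^k$. Let $\lambda_x$, $q_n(z)$, the algebra of differential operators $\mathfrak{D}_\beta=\mathbb{R}\langle \mathcal{D}_1,\mathcal{D}_2\rangle$ and the algebra $\mathcal{A}^{\alpha,\beta;a}\subset\mathbb{R}[t]$ be as defined in the context. Then for every $f\in\mathcal{A}^{\alpha,\beta;a}$ there exists $B_f=B_f(\mathcal{D}_1,\mathcal{D}_2)\in\mathfrak{D}_\beta$ (independent of $n$) such that $$B_f\,q_n(z)=f(\lambda_{n-k/2})\,q_n(z)\qquad\text{for all } n\in\mathbb{N}_0 .$$ Thus, $\mathcal{D}^{\alpha,\beta;a}=\{B_f: f\in\mathcal{A}^{\alpha,\beta;a}\}$ is a commutative subalgebra of $\mathfrak{D}_\beta$, isomorphic to $\mathcal{A}^{\alpha,\beta;a}$ (via $f\mapsto B_f$).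
   Context: Notation. $(c)_0=1$, $(c)_m=c(c+1)\cdots(c+m-1)$ for $m\ge1$. For $x\in\mathbb{R}$ (or $x$ a polynomial in $n$), $\lambda_x=\lambda_x^{\alpha+\beta}=x(x+\alpha+\beta+1)$. Jacobi polynomials: for $n\in\mathbb{N}_0$, $$p^{\alpha,\beta}_n(z)=(-1)^n\frac{(\alpha+\beta+1)_n}{n!}\,{}_2F_1(-n,n+\alpha+\beta+1;\beta+1;z),$$ and $p^{\alpha,\beta}_n(z)=0$ for $n<0$. Discrete Wronskian: $\mathrm{Wr}_n(h^{(1)}_n,\dots,h^{(m)}_n)=\det\big(h^{(i)}_{n-j+1}\big)_{1\le i,j\le m}$. For $0\le j\le k-1$ define the polynomials in $n$ $$\phi^{1,j}_n=\frac{(-1)^j(n+1)_j(-n-\alpha-\beta)_j}{j!\,(1-\alpha)_j},\qquad \phi^{2,j}_n=\frac{(-1)^j(n+1)_\alpha(n+\beta+1)_\alpha(-n)_j(n+\alpha+\beta+1)_j}{j!\,\alpha!\,(1+\alpha)_j(1+\beta)_\alpha},$$ $$\psi^{(j)}_n=\sum_{l=0}^{j}a_{j-l}\,\phi^{1,l}_n+\phi^{2,j}_n .$$ As polynomials in $n$, the $\psi^{(j)}_n$ are evaluated at all values of $n$, including negative ones. Put $$q_n(z)=\mathrm{Wr}_n(\psi^{(0)}_n,\dots,\psi^{(k-1)}_n,p^{\alpha,\beta}_n(z))\quad(n\in\mathbb{N}_0),\qquad \tau_n=\mathrm{Wr}_n(\psi^{(0)}_n,\dots,\psi^{(k-1)}_n)\in\mathbb{R}[n].$$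 $\mathfrak{D}_\beta=\mathbb{R}\langle\mathcal{D}_1,\mathcal{D}_2\rangle$ is the associative algebra (with unit) of ordinary differential operators generated by $$\mathcal{D}_1=z\partial_z,\qquad \mathcal{D}_2=z\partial_z^2+(\beta+1)\partial_z .$$ $\mathcal{A}^{\alpha,\beta;a}$ is the algebra of all $f\in\mathbb{R}[t]$ such that $f(\lambda_{n-k/2})-f(\lambda_{n-k/2-1})$ is divisible by $\tau_{n-1}$ in $\mathbb{R}[n]$. *)

theory Defs
  imports "Jordan_Normal_Form.Determinant"
begin

(* \<lambda>\<^sub>x with s = \<alpha> + \<beta>; used both for x real and for x a polynomial in n. *)
definition lam :: "'a::comm_ring_1 \<Rightarrow> 'a \<Rightarrow> 'a" where
  "lam s x = x * (x + s + 1)"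

(* The hypergeometric series terminates, since (-n)_m = 0 for m > n. *)
definition jacobi :: "real \<Rightarrow> real \<Rightarrow> int \<Rightarrow> real poly" where
  "jacobi \<alpha> \<beta> n = (if n < 0 then 0 else
     smult ((-1) ^ nat n * pochhammer (\<alpha> + \<beta> + 1) (nat n) / fact (nat n))
       (\<Sum>m\<le>nat n. monom (pochhammer (- of_int n) m * pochhammer (of_int n + \<alpha> + \<beta> + 1) m
                            / (pochhammer (\<beta> + 1) m * fact m)) m))"

(* Rows and columns are numbered from 0, so the (i, j) entry is h_i at n - j. *)
definition Wr :: "(int \<Rightarrow> 'a::comm_ring_1) list \<Rightarrow> int \<Rightarrow> 'a" where
  "Wr hs n = det (mat (length hs) (length hs) (\<lambda>(i, j). (hs ! i) (n - int j)))"

(* phi1, phi2, psi and tau are polynomials in n: the variable n is the polynomial [:0, 1:]. *)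
definition phi1 :: "nat \<Rightarrow> real \<Rightarrow> nat \<Rightarrow> real poly" where
  "phi1 \<alpha> \<beta> j = smult ((-1) ^ j / (fact j * pochhammer (1 - real \<alpha>) j))
     (pochhammer [:1, 1:] j * pochhammer [:- real \<alpha> - \<beta>, -1:] j)"

definition phi2 :: "nat \<Rightarrow> real \<Rightarrow> nat \<Rightarrow> real poly" where
  "phi2 \<alpha> \<beta> j =
     smult ((-1) ^ j / (fact j * fact \<alpha> * pochhammer (1 + real \<alpha>) j * pochhammer (1 + \<beta>) \<alpha>))
       (pochhammer [:1, 1:] \<alpha> * pochhammer [:\<beta> + 1, 1:] \<alpha>
        * pochhammer [:0, -1:] j * pochhammer [:real \<alpha> + \<beta> + 1, 1:] j)"

definition psi :: "nat \<Rightarrow> real \<Rightarrow> (nat \<Rightarrow> real) \<Rightarrow> nat \<Rightarrow> real poly" where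
  "psi \<alpha> \<beta> a j = (\<Sum>l\<le>j. smult (a (j - l)) (phi1 \<alpha> \<beta> l)) + phi2 \<alpha> \<beta> j"

(* An element of R[z] for each n; the numbers psi_n enter as constant polynomials in z. *)
definition q :: "nat \<Rightarrow> real \<Rightarrow> nat \<Rightarrow> (nat \<Rightarrow> real) \<Rightarrow> nat \<Rightarrow> real poly" where
  "q \<alpha> \<beta> k a n =
     Wr (map (\<lambda>j m. [:poly (psi \<alpha> \<beta> a j) (of_int m):]) [0..<k] @ [jacobi (real \<alpha>) \<beta>]) (int n)"

(* An element of R[n]: the sequence with index m has the polynomial psi_(n+m) as its value,
   and the Wronskian is taken at m = 0. *)
definition tau :: "nat \<Rightarrow> real \<Rightarrow> nat \<Rightarrow> (nat \<Rightarrow> real) \<Rightarrow> real poly" where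
  "tau \<alpha> \<beta> k a = Wr (map (\<lambda>j m. psi \<alpha> \<beta> a j \<circ>\<^sub>p [:of_int m, 1:]) [0..<k]) 0"

(* Differential operators with polynomial coefficients are identified with the linear maps they
   induce on R[z]; this identification is faithful because the coefficients are real.
   Multiplication of operators is composition, the unit is id. *)
inductive_set generated_algebra :: "(real poly \<Rightarrow> real poly) set \<Rightarrow> (real poly \<Rightarrow> real poly) set"
  for S where
  gen: "L \<in> S \<Longrightarrow> L \<in> generated_algebra S"
| one: "id \<in> generated_algebra S"
| add: "L \<in> generated_algebra S \<Longrightarrow> M \<in> generated_algebra S
          \<Longrightarrow> (\<lambda>p. L p + M p) \<in> generated_algebra S"
| scale: "L \<in> generated_algebra S \<Longrightarrow> (\<lambda>p. smult c (L p)) \<in> generated_algebra S"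
| mult: "L \<in> generated_algebra S \<Longrightarrow> M \<in> generated_algebra S \<Longrightarrow> L \<circ> M \<in> generated_algebra S"

definition D1 :: "real poly \<Rightarrow> real poly" where
  "D1 p = [:0, 1:] * pderiv p"

definition D2 :: "real \<Rightarrow> real poly \<Rightarrow> real poly" where
  "D2 \<beta> p = [:0, 1:] * pderiv (pderiv p) + smult (\<beta> + 1) (pderiv p)"

definition D_alg :: "real \<Rightarrow> (real poly \<Rightarrow> real poly) set" where
  "D_alg \<beta> = generated_algebra {D1, D2 \<beta>}"

definition A_alg :: "nat \<Rightarrow> real \<Rightarrow> nat \<Rightarrow> (nat \<Rightarrow> real) \<Rightarrow> real poly set" where
  "A_alg \<alpha> \<beta> k a =
     {f. (tau \<alpha> \<beta> k a \<circ>\<^sub>p [:-1, 1:]) dvd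
         (f \<circ>\<^sub>p lam [:real \<alpha> + \<beta>:] [:- (real k / 2), 1:]
          - f \<circ>\<^sub>p lam [:real \<alpha> + \<beta>:] [:- (real k / 2) - 1, 1:])}"

lemma A_alg_subalgebra:
  shows "1 \<in> A_alg \<alpha> \<beta> k a"
    and "f \<in> A_alg \<alpha> \<beta> k a \<Longrightarrow> g \<in> A_alg \<alpha> \<beta> k a \<Longrightarrow> f + g \<in> A_alg \<alpha> \<beta> k a"
    and "f \<in> A_alg \<alpha> \<beta> k a \<Longrightarrow> smult c f \<in> A_alg \<alpha> \<beta> k a"
    and "f \<in> A_alg \<alpha> \<beta> k a \<Longrightarrow> g \<in> A_alg \<alpha> \<beta> k a \<Longrightarrow> f * g \<in> A_alg \<alpha> \<beta> k a"
proof -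
  show "1 \<in> A_alg \<alpha> \<beta> k a" by (simp add: A_alg_def pcompose_1)
  show "f + g \<in> A_alg \<alpha> \<beta> k a" if "f \<in> A_alg \<alpha> \<beta> k a" "g \<in> A_alg \<alpha> \<beta> k a"
    using that dvd_add unfolding A_alg_def by (fastforce simp: pcompose_add add_diff_add)
  show "smult c f \<in> A_alg \<alpha> \<beta> k a" if "f \<in> A_alg \<alpha> \<beta> k a"
    using that unfolding A_alg_def
    by (simp add: pcompose_smult smult_diff_right[symmetric] dvd_smult)
  have *: "x dvd u * v - u' * v'" if "x dvd u - u'" "x dvd v - v'" for x u u' v v' :: "real poly"
  proof -
    have "u * v - u' * v' = (u - u') * v + u' * (v - v')" by (simp add: algebra_simps)
    with that show ?thesis by simp
  qed
  show "f * g \<in> A_alg \<alpha> \<beta> k a" if "f \<in> A_alg \<alpha> \<beta> k a" "g \<in> A_alg \<alpha> \<beta> k a"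
    using that unfolding A_alg_def by (simp add: pcompose_mult *)
qed

definition comm_subalgebra ::
  "(real poly \<Rightarrow> real poly) set \<Rightarrow> (real poly \<Rightarrow> real poly) set \<Rightarrow> bool" where
  "comm_subalgebra V W \<longleftrightarrow> V \<subseteq> W \<and> id \<in> V \<and>
     (\<forall>L\<in>V. \<forall>M\<in>V. (\<lambda>p. L p + M p) \<in> V) \<and>
     (\<forall>c. \<forall>L\<in>V. (\<lambda>p. smult c (L p)) \<in> V) \<and>
     (\<forall>L\<in>V. \<forall>M\<in>V. L \<circ> M \<in> V) \<and>
     (\<forall>L\<in>V. \<forall>M\<in>V. L \<circ> M = M \<circ> L)"

definition algebra_iso ::
  "(real poly \<Rightarrow> (real poly \<Rightarrow> real poly)) \<Rightarrow> real poly set \<Rightarrow> (real poly \<Rightarrow> real poly) set \<Rightarrow> bool" where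
  "algebra_iso h A V \<longleftrightarrow> bij_betw h A V \<and> h 1 = id \<and>
     (\<forall>f\<in>A. \<forall>g\<in>A. h (f + g) = (\<lambda>p. h f p + h g p)) \<and>
     (\<forall>c. \<forall>f\<in>A. h (smult c f) = (\<lambda>p. smult c (h f p))) \<and>
     (\<forall>f\<in>A. \<forall>g\<in>A. h (f * g) = h f \<circ> h g)"

end

theory Submission
  imports Defs
begin

text \<open>
Write \<open>p n\<close> for the Jacobi polynomials, \<open>S = \<alpha> + \<beta> + 1\<close>, and call a polynomial in \<open>n\<close>
invariant or anti-invariant according to its behaviour under the reflection \<open>n \<mapsto> - n - S\<close>,
which fixes \<open>lam n = n (n + S)\<close>.

Two elements of the algebra are known explicitly on the \<open>p n\<close>. A combination \<open>Lam\<close> of the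
generators has \<open>p n\<close> as eigenvector with eigenvalue \<open>lam n\<close>, and \<open>D1\<close> maps \<open>p n\<close> to
\<open>n p n + (\<Sum>j<n. (2 j + S) p j)\<close>. Together they produce all operators
\<open>p n \<mapsto> g n * (h n / 2 * p n + (\<Sum>j<n. h j * p j))\<close> with \<open>g\<close> invariant and \<open>h\<close>
anti-invariant, and all diagonal operators with invariant eigenvalues
(\<open>perturbed_operator_in_D_alg\<close>). The \<open>psi l\<close> are invariant, so one can look for the operator
that belongs to an eigenvalue \<open>U n\<close> in the form
\<open>X (p n) = U n * p n + (\<Sum>l<k. psi l n * (\<Sum>j<n. H l j * p j))\<close>.

The Wronskian \<open>q n\<close> is a combination of \<open>p n, \<dots>, p (n - k)\<close> whose coefficients annihilate
every \<open>psi l\<close>. When \<open>X\<close> is applied to it, the long partial sums therefore cancel, and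
\<open>X (q n) = U n * q n\<close> reduces to \<open>k\<close> linear conditions on the weights \<open>H l\<close>
(\<open>perturbed_operator_eigenvector\<close>). They are solved by Cramer's rule on the windows of \<open>k\<close>
consecutive integers that contain \<open>j\<close>: up to sign, each window contributes the difference
\<open>U (t + 1) - U t\<close>, with \<open>t\<close> the top of the window, times an entry of the inverse of the
Casorati matrix \<open>(psi l (t - i))\<close> (\<open>window_functional_identity\<close>). The determinant of that
matrix is \<open>tau\<close>, so the condition defining \<open>A_alg\<close> says that these contributions are
polynomials in \<open>t\<close>. The reflection maps windows to windows, which makes \<open>H l\<close> anti-invariant
(\<open>window_kernels\<close>), and the diagonal of \<open>X\<close> is compatible with it because \<open>U\<close> is a
polynomial in \<open>lam (n - k / 2)\<close>.

The degrees of the \<open>psi l\<close> are distinct, so \<open>tau\<close> is not the zero polynomial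
(\<open>det_casorati_nonzero\<close>) and \<open>q n\<close> has degree \<open>n\<close> for all large \<open>n\<close>. An element of the
algebra is determined by its action on such a sequence
(\<open>D_alg_zero_of_kills_degree_sequence\<close>). Hence the operators are unique, and sums, products and
commutativity can be checked on eigenvalues.
\<close>

section \<open>Casorati determinants of independent polynomials\<close>

lemma sum_mult_cofactor_column:
  assumes A: "(A :: 'a :: comm_ring_1 mat) \<in> carrier_mat n n" and "j < n" "j' < n"
  shows "(\<Sum>l<n. cofactor A l j * A $$ (l, j')) = (if j = j' then det A else 0)"
proof -
  have "(adj_mat A * A) $$ (j, j') = (\<Sum>l<n. cofactor A l j * A $$ (l, j'))"
    using assms adj_mat(1)[OF A]
    by (simp add: adj_mat_def scalar_prod_def lessThan_atLeast0)
  then show ?thesis using adj_mat(3)[OF A] assms by (cases "j = j'") auto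
qed

lemma sum_mult_cofactor_row:
  assumes A: "(A :: 'a :: comm_ring_1 mat) \<in> carrier_mat n n" and "i < n" "i' < n"
  shows "(\<Sum>l<n. A $$ (i, l) * cofactor A i' l) = (if i = i' then det A else 0)"
proof -
  have "(A * adj_mat A) $$ (i, i') = (\<Sum>l<n. A $$ (i, l) * cofactor A i' l)"
    using assms adj_mat(1)[OF A]
    by (simp add: adj_mat_def scalar_prod_def lessThan_atLeast0)
  then show ?thesis using adj_mat(2)[OF A] assms by (cases "i = i'") auto
qed

lemma rows_independent_of_det_nonzero:
  assumes A: "(A :: 'a :: idom mat) \<in> carrier_mat n n" and det: "det A \<noteq> 0"
    and E: "\<And>j. j < n \<Longrightarrow> (\<Sum>l<n. E l * A $$ (l, j)) = 0" and "i < n"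
  shows "E i = 0"
proof -
  have "E i * det A = (\<Sum>l<n. E l * (\<Sum>j<n. A $$ (l, j) * cofactor A i j))"
    using \<open>i < n\<close> by (simp add: sum_mult_cofactor_row[OF A] if_distrib[of "(*) _"] cong: if_cong)
  also have "\<dots> = (\<Sum>l<n. \<Sum>j<n. E l * A $$ (l, j) * cofactor A i j)"
    by (simp add: sum_distrib_left mult.assoc)
  also have "\<dots> = (\<Sum>j<n. \<Sum>l<n. E l * A $$ (l, j) * cofactor A i j)"
    by (rule sum.swap)
  also have "\<dots> = (\<Sum>j<n. (\<Sum>l<n. E l * A $$ (l, j)) * cofactor A i j)"
    by (simp add: sum_distrib_right)
  also have "\<dots> = 0" using E by simp
  finally show ?thesis using det by simp
qed

lemma rows_dependent_of_det_zero:
  assumes A: "(A :: 'a :: field mat) \<in> carrier_mat n n" and det: "det A = 0"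
  obtains E i where "i < n" "E i \<noteq> 0" "\<And>j. j < n \<Longrightarrow> (\<Sum>l<n. E l * A $$ (l, j)) = 0"
proof -
  have T: "transpose_mat A \<in> carrier_mat n n" using A by simp
  have "det (transpose_mat A) = 0" using det det_transpose[OF A] by simp
  then obtain v where v: "v \<in> carrier_vec n" "v \<noteq> 0\<^sub>v n" "transpose_mat A *\<^sub>v v = 0\<^sub>v n"
    using det_0_iff_vec_prod_zero_field[OF T] by auto
  from v(1,2) obtain i where i: "i < n" "v $ i \<noteq> 0" by (metis eq_vecI carrier_vecD index_zero_vec)
  have "(\<Sum>l<n. v $ l * A $$ (l, j)) = 0" if "j < n" for j
  proof -
    have "(transpose_mat A *\<^sub>v v) $ j = (\<Sum>l<n. v $ l * A $$ (l, j))"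
      using that A v(1) by (simp add: scalar_prod_def lessThan_atLeast0 mult.commute)
    then show ?thesis using v(3) that by simp
  qed
  with i show thesis using that by blast
qed

definition casorati :: "nat \<Rightarrow> (nat \<Rightarrow> real poly) \<Rightarrow> real poly mat" where
  "casorati k f = mat k k (\<lambda>(l, j). f l \<circ>\<^sub>p [:- real j, 1:])"

lemma casorati_carrier [simp]: "casorati k f \<in> carrier_mat k k"
  by (simp add: casorati_def)

lemma casorati_index: "l < k \<Longrightarrow> j < k \<Longrightarrow> casorati k f $$ (l, j) = f l \<circ>\<^sub>p [:- real j, 1:]"
  by (simp add: casorati_def)

lemma poly_det: "poly (det A) x = det (map_mat (\<lambda>p. poly p x) A)"
proof -
  interpret ev: comm_ring_hom "\<lambda>p. poly p x" by unfold_locales simp_all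
  show ?thesis by simp
qed

lemma poly_det_casorati:
  "poly (det (casorati k f)) x = det (mat k k (\<lambda>(l, j). poly (f l) (x - real j)))"
  unfolding poly_det by (rule arg_cong[where f = det]) (auto simp: casorati_def poly_pcompose)

lemma eventually_nonzero_on_nat:
  assumes "(p :: real poly) \<noteq> 0"
  obtains n0 where "\<And>n::nat. n \<ge> n0 \<Longrightarrow> poly p (real n) \<noteq> 0"
proof -
  have "finite (real -` {x. poly p x = 0})"
    by (rule finite_vimageI[OF poly_roots_finite[OF assms]]) (simp add: inj_on_def)
  then obtain n0 where "\<forall>n \<in> real -` {x. poly p x = 0}. n < n0"
    using finite_nat_set_iff_bounded by blast
  then show thesis using that[of n0] by (metis (mono_tags) leD mem_Collect_eq vimage_eq)
qed

lemma poly_zero_of_eventually_zero_on_nat: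
  assumes "\<And>n::nat. n \<ge> n0 \<Longrightarrow> poly p (real n) = (0::real)"
  shows "p = 0"
  using eventually_nonzero_on_nat[of p] assms by (metis max.cobounded1 max.cobounded2)

text \<open>
Suppose that the determinant for \<open>Suc k\<close> functions vanishes while the one for the first
\<open>k\<close> of them does not. At every large \<open>n\<close> the rows then satisfy a linear relation, which is
unique once the coefficient of \<open>f k\<close> is \<open>1\<close>. The relations at \<open>n\<close> and \<open>n + 1\<close> both hold at
the \<open>k\<close> points \<open>n, \<dots>, n - k + 1\<close>, which already determine them, so the coefficients do not
depend on \<open>n\<close>: they give a linear relation between the polynomials.
\<close>
lemma det_casorati_nonzero:
  assumes "\<And>c. (\<Sum>l<k. smult (c l) (f l)) = 0 \<Longrightarrow> \<forall>l<k. c l = 0"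
  shows "det (casorati k f) \<noteq> 0"
  using assms
proof (induction k)
  case 0
  then show ?case by (simp add: casorati_def det_dim_zero)
next
  case (Suc k)
  let ?M = "\<lambda>k x. mat k k (\<lambda>(l, j). poly (f l) (x - real j))"
  have "det (casorati k f) \<noteq> 0"
  proof (rule Suc.IH)
    fix c assume c: "(\<Sum>l<k. smult (c l) (f l)) = 0"
    have "(\<Sum>l<Suc k. smult ((c(k := 0)) l) (f l)) = 0" using c by simp
    from Suc.prems[OF this] show "\<forall>l<k. c l = 0" by (metis fun_upd_apply less_Suc_eq less_irrefl)
  qed
  then obtain n0 where n0: "\<And>n::nat. n \<ge> n0 \<Longrightarrow> det (?M k (real n)) \<noteq> 0"
    using eventually_nonzero_on_nat poly_det_casorati by metis
  show ?case
  proof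
    assume zero: "det (casorati (Suc k) f) = 0"
    have "\<exists>c. c k = 1 \<and> (\<forall>j\<le>k. (\<Sum>l\<le>k. c l * poly (f l) (real n - real j)) = 0)"
      if "n \<ge> n0" for n :: nat
    proof -
      have "det (?M (Suc k) (real n)) = 0" using zero poly_det_casorati[of "Suc k" f "real n"] by simp
      then obtain v i where v: "i < Suc k" "v i \<noteq> 0"
          "\<And>j. j < Suc k \<Longrightarrow> (\<Sum>l<Suc k. v l * ?M (Suc k) (real n) $$ (l, j)) = 0"
        by (rule rows_dependent_of_det_zero[OF mat_carrier]) blast
      have v': "(\<Sum>l\<le>k. v l * poly (f l) (real n - real j)) = 0" if "j \<le> k" for j
        using v(3)[of j] that by (simp add: lessThan_Suc_atMost[symmetric] del: sum.lessThan_Suc)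
      have "v k \<noteq> 0"
      proof
        assume k0: "v k = 0"
        have "v l = 0" if "l < k" for l
        proof (rule rows_independent_of_det_nonzero[OF _ n0[OF \<open>n \<ge> n0\<close>] _ that])
          fix j assume "j < k"
          then show "(\<Sum>l<k. v l * ?M k (real n) $$ (l, j)) = 0"
            using v'[of j] k0 by (simp add: lessThan_Suc_atMost[symmetric])
        qed simp
        with k0 v show False by (metis less_antisym)
      qed
      moreover have "(\<Sum>l\<le>k. v l / v k * poly (f l) (real n - real j)) = 0" if "j \<le> k" for j
      proof -
        have "(\<Sum>l\<le>k. v l / v k * poly (f l) (real n - real j))
            = (\<Sum>l\<le>k. v l * poly (f l) (real n - real j)) / v k"
          by (simp add: sum_divide_distrib)
        then show ?thesis using v'[OF that] by simp
      qed
      ultimately show ?thesis by (intro exI[of _ "\<lambda>l. v l / v k"]) simp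
    qed
    then obtain c where c: "\<And>n. n \<ge> n0 \<Longrightarrow> c n k = 1"
      "\<And>n j. n \<ge> n0 \<Longrightarrow> j \<le> k \<Longrightarrow> (\<Sum>l\<le>k. c n l * poly (f l) (real n - real j)) = 0" by metis
    \<comment> \<open>Column \<open>j + 1\<close> of the window at \<open>n + 1\<close> is column \<open>j\<close> of the window at \<open>n\<close>.\<close>
    have step: "c (Suc n) l = c n l" if n: "n \<ge> n0" and l: "l \<le> k" for n l
    proof (cases "l = k")
      case True
      then show ?thesis using c(1) n by simp
    next
      case False
      have "c (Suc n) l - c n l = 0"
      proof (rule rows_independent_of_det_nonzero[OF _ n0[OF n]])
        fix j assume j: "j < k"
        have "(\<Sum>l\<le>k. c (Suc n) l * poly (f l) (real n - real j)) = 0"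
          using c(2)[of "Suc n" "Suc j"] n j by simp
        moreover have "(\<Sum>l\<le>k. c n l * poly (f l) (real n - real j)) = 0"
          using c(2)[of n j] n j by simp
        ultimately have "(\<Sum>l\<le>k. (c (Suc n) l - c n l) * poly (f l) (real n - real j)) = 0"
          by (simp add: left_diff_distrib sum_subtractf)
        then show "(\<Sum>l<k. (c (Suc n) l - c n l) * ?M k (real n) $$ (l, j)) = 0"
          using j c(1) n by (simp add: lessThan_Suc_atMost[symmetric])
      qed (use False l in auto)
      then show ?thesis by simp
    qed
    have const: "c n l = c n0 l" if "n \<ge> n0" "l \<le> k" for n l
      using that by (induction n rule: dec_induct) (use step in auto)
    have "(\<Sum>l<Suc k. smult (c n0 l) (f l)) = 0"
    proof (rule poly_zero_of_eventually_zero_on_nat)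
      fix n assume "n \<ge> n0"
      then show "poly (\<Sum>l<Suc k. smult (c n0 l) (f l)) (real n) = 0"
        using c(2)[of n 0] const[of n] by (simp add: poly_sum lessThan_Suc_atMost del: sum.lessThan_Suc)
    qed
    from Suc.prems[OF this] c(1)[of n0] show False by simp
  qed
qed

lemma increasing_degree_independent:
  fixes f :: "nat \<Rightarrow> real poly"
  assumes inc: "\<And>i j. i < j \<Longrightarrow> j < k \<Longrightarrow> degree (f i) < degree (f j)"
    and nz: "\<And>l. l < k \<Longrightarrow> f l \<noteq> 0"
    and zero: "(\<Sum>l<k. smult (c l) (f l)) = 0"
  shows "\<forall>l<k. c l = 0"
proof (rule ccontr)
  assume "\<not> (\<forall>l<k. c l = 0)"
  then have ne: "{l. l < k \<and> c l \<noteq> 0} \<noteq> {}" by auto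
  define m where "m = Max {l. l < k \<and> c l \<noteq> 0}"
  have m: "m < k" "c m \<noteq> 0" using Max_in[OF _ ne] by (auto simp: m_def)
  have above: "c l = 0" if "l < k" "m < l" for l
    using Max_ge[of "{l. l < k \<and> c l \<noteq> 0}" l] that by (auto simp: m_def[symmetric])
  have "coeff (\<Sum>l<k. smult (c l) (f l)) (degree (f m))
      = (\<Sum>l<k. if l = m then c m * lead_coeff (f m) else 0)"
    unfolding coeff_sum
  proof (rule sum.cong[OF refl])
    fix l assume "l \<in> {..<k}"
    then show "coeff (smult (c l) (f l)) (degree (f m)) = (if l = m then c m * lead_coeff (f m) else 0)"
      using inc[of l m] above[of l] m by (cases l m rule: linorder_cases) (auto simp: coeff_eq_0)
  qed
  then show False using zero m nz[of m] by simp
qed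

section \<open>The algebra of differential operators and its faithful action\<close>

text \<open>
These are the operators \<open>z^m \<mapsto> \<Sum>d\<le>R. c d m * z^(m - d)\<close> with polynomials \<open>c d\<close>. The form is
stable under composition without any normal ordering of \<open>z\<close> and \<open>\<partial>\<close>, and the \<open>c d\<close> can be
read off one after the other. Indexing by the exponent \<open>j\<close> of the result avoids a case
distinction for \<open>m < d\<close>.
\<close>
definition shift_form :: "(real poly \<Rightarrow> real poly) \<Rightarrow> bool" where
  "shift_form L \<longleftrightarrow> (\<exists>R c. \<forall>p j. coeff (L p) j = (\<Sum>d\<le>R. poly (c d) (real (j + d)) * coeff p (j + d)))"

lemma shift_form_comp:
  assumes "shift_form L" "shift_form M"
  shows "shift_form (L \<circ> M)"
proof -
  obtain R c where L: "\<And>p j. coeff (L p) j = (\<Sum>d\<le>R. poly (c d) (real (j + d)) * coeff p (j + d))"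
    using assms(1) unfolding shift_form_def by blast
  obtain R' c' where M: "\<And>p j. coeff (M p) j = (\<Sum>e\<le>R'. poly (c' e) (real (j + e)) * coeff p (j + e))"
    using assms(2) unfolding shift_form_def by blast
  \<comment> \<open>\<open>c'\<close> sees the exponent \<open>x\<close> of the argument and lowers it by \<open>e\<close> before \<open>c\<close> sees it.\<close>
  define c'' where "c'' D = (\<Sum>(d, e) \<in> {u \<in> {..R} \<times> {..R'}. fst u + snd u = D}.
      (c d \<circ>\<^sub>p [:- real e, 1:]) * c' e)" for D
  have "coeff (L (M p)) j = (\<Sum>D\<le>R+R'. poly (c'' D) (real (j + D)) * coeff p (j + D))" for p j
  proof -
    let ?h = "\<lambda>u. poly ((c (fst u) \<circ>\<^sub>p [:- real (snd u), 1:]) * c' (snd u)) (real (j + (fst u + snd u)))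
                  * coeff p (j + (fst u + snd u))"
    have "coeff (L (M p)) j = (\<Sum>d\<le>R. \<Sum>e\<le>R'. ?h (d, e))"
      by (simp add: L M sum_distrib_left poly_pcompose algebra_simps)
    also have "\<dots> = sum ?h ({..R} \<times> {..R'})"
      by (simp add: sum.cartesian_product case_prod_beta)
    also have "\<dots> = (\<Sum>D\<le>R+R'. sum ?h {u \<in> {..R} \<times> {..R'}. fst u + snd u = D})"
      by (rule sum.group[symmetric]) auto
    also have "\<dots> = (\<Sum>D\<le>R+R'. poly (c'' D) (real (j + D)) * coeff p (j + D))"
      by (intro sum.cong[OF refl])
        (auto simp: c''_def poly_sum sum_distrib_right case_prod_beta intro!: sum.cong)
    finally show ?thesis .
  qed
  then show ?thesis unfolding shift_form_def o_def by blast
qed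

lemma shift_form_add:
  assumes "shift_form L" "shift_form M"
  shows "shift_form (\<lambda>p. L p + M p)"
proof -
  obtain R c where L: "\<And>p j. coeff (L p) j = (\<Sum>d\<le>R. poly (c d) (real (j + d)) * coeff p (j + d))"
    using assms(1) unfolding shift_form_def by blast
  obtain R' c' where M: "\<And>p j. coeff (M p) j = (\<Sum>e\<le>R'. poly (c' e) (real (j + e)) * coeff p (j + e))"
    using assms(2) unfolding shift_form_def by blast
  have pad: "(\<Sum>d\<le>r. g d) = (\<Sum>d\<le>max R R'. if d \<le> r then g d else 0)"
    if "r \<le> max R R'" for r and g :: "nat \<Rightarrow> real"
    by (rule sum.mono_neutral_cong_left) (use that in auto)
  have "coeff (L p + M p) j = (\<Sum>d\<le>max R R'.
      poly ((if d \<le> R then c d else 0) + (if d \<le> R' then c' d else 0)) (real (j + d)) * coeff p (j + d))" for p j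
    unfolding coeff_add L M pad[of R, simplified] pad[of R', simplified] sum.distrib[symmetric]
    by (intro sum.cong) (auto simp: algebra_simps)
  then show ?thesis unfolding shift_form_def
    by (intro exI[of _ "max R R'"] exI[of _ "\<lambda>d. (if d \<le> R then c d else 0) + (if d \<le> R' then c' d else 0)"]) blast
qed

lemma D_alg_shift_form: "L \<in> D_alg \<beta> \<Longrightarrow> shift_form L"
  unfolding D_alg_def
proof (induction rule: generated_algebra.induct)
  case (gen L)
  have "coeff (D1 p) j = (\<Sum>d\<le>0. poly [:0, 1:] (real (j + d)) * coeff p (j + d))" for p j
    by (cases j) (simp_all add: D1_def coeff_pderiv)
  then have 1: "shift_form D1" unfolding shift_form_def
    by (intro exI[of _ 0] exI[of _ "\<lambda>_. [:0, 1:]"]) blast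
  have "coeff (D2 \<beta> p) j =
      (\<Sum>d\<le>1. poly (if d = 0 then 0 else [:0, \<beta>, 1:]) (real (j + d)) * coeff p (j + d))" for p j
    by (cases j) (simp_all add: D2_def coeff_pderiv algebra_simps)
  then have "shift_form (D2 \<beta>)" unfolding shift_form_def
    by (intro exI[of _ 1] exI[of _ "\<lambda>d::nat. if d = 0 then 0 else [:0, \<beta>, 1:]"]) blast
  with 1 gen show ?case by auto
next
  case one
  have "coeff (id p) j = (\<Sum>d\<le>0. poly 1 (real (j + d)) * coeff p (j + d))" for p :: "real poly" and j by simp
  then show ?case unfolding shift_form_def by (intro exI[of _ 0] exI[of _ "\<lambda>_. 1"]) blast
next
  case (add L M)
  then show ?case by (simp add: shift_form_add)
next
  case (scale L a)
  then obtain R c where L: "\<And>p j. coeff (L p) j = (\<Sum>d\<le>R. poly (c d) (real (j + d)) * coeff p (j + d))"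
    unfolding shift_form_def by blast
  show ?case unfolding shift_form_def
    by (intro exI[of _ R] exI[of _ "\<lambda>d. smult a (c d)"]) (simp add: L sum_distrib_left mult.assoc)
next
  case (mult L M)
  then show ?case by (intro shift_form_comp)
qed

lemma D_alg_linear:
  assumes "L \<in> D_alg \<beta>"
  shows "L (p + r) = L p + L r" and "L (smult x p) = smult x (L p)"
proof -
  obtain R c where L: "\<And>p j. coeff (L p) j = (\<Sum>d\<le>R. poly (c d) (real (j + d)) * coeff p (j + d))"
    using D_alg_shift_form[OF assms] unfolding shift_form_def by blast
  show "L (p + r) = L p + L r"
    by (rule poly_eqI) (simp add: L sum.distrib distrib_left)
  show "L (smult x p) = smult x (L p)"
    by (rule poly_eqI) (simp add: L sum_distrib_left mult_ac)
qed

lemma D_alg_sum: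
  assumes "L \<in> D_alg \<beta>"
  shows "L (sum g A) = (\<Sum>i\<in>A. L (g i))"
proof -
  have "L 0 = 0" using D_alg_linear(2)[OF assms, of 0 0] by simp
  then show ?thesis by (induction A rule: infinite_finite_induct) (simp_all add: D_alg_linear(1)[OF assms])
qed

lemma D_alg_id: "id \<in> D_alg \<beta>"
  unfolding D_alg_def by (rule generated_algebra.one)

lemma D_alg_add: "L \<in> D_alg \<beta> \<Longrightarrow> M \<in> D_alg \<beta> \<Longrightarrow> (\<lambda>p. L p + M p) \<in> D_alg \<beta>"
  unfolding D_alg_def by (rule generated_algebra.add)

lemma D_alg_smult: "L \<in> D_alg \<beta> \<Longrightarrow> (\<lambda>p. smult c (L p)) \<in> D_alg \<beta>"
  unfolding D_alg_def by (rule generated_algebra.scale)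

lemma D_alg_comp: "L \<in> D_alg \<beta> \<Longrightarrow> M \<in> D_alg \<beta> \<Longrightarrow> (\<lambda>p. L (M p)) \<in> D_alg \<beta>"
  unfolding D_alg_def by (drule (1) generated_algebra.mult) (simp add: o_def)

lemma D_alg_sum_closed:
  assumes "\<And>i. i \<in> I \<Longrightarrow> L i \<in> D_alg \<beta>"
  shows "(\<lambda>p. \<Sum>i\<in>I. L i p) \<in> D_alg \<beta>"
  using assms
proof (induction I rule: infinite_finite_induct)
  case (infinite A)
  then show ?case using D_alg_smult[OF D_alg_id, of 0] by simp
next
  case empty
  then show ?case using D_alg_smult[OF D_alg_id, of 0] by simp
next
  case (insert x F)
  then show ?case by (simp add: D_alg_add)
qed

lemma D1_in_D_alg: "D1 \<in> D_alg \<beta>" and D2_in_D_alg: "D2 \<beta> \<in> D_alg \<beta>"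
  unfolding D_alg_def by (auto intro: generated_algebra.gen)

lemma D_alg_minus:
  assumes "L \<in> D_alg \<beta>" "M \<in> D_alg \<beta>"
  shows "(\<lambda>p. L p - M p) \<in> D_alg \<beta>"
proof -
  have "(\<lambda>p. L p + smult (-1) (M p)) \<in> D_alg \<beta>"
    using assms unfolding D_alg_def by (intro generated_algebra.add generated_algebra.scale)
  then show ?thesis by simp
qed

text \<open>
The coefficient of \<open>z^n\<close> in \<open>L (Q n)\<close> is \<open>c 0 n\<close> times the leading coefficient of \<open>Q n\<close>, so
\<open>c 0\<close> has infinitely many zeros and vanishes. Then the coefficient of \<open>z^(n-1)\<close> involves \<open>c 1\<close>
only, and so on: a differential operator is determined by its values on polynomials of
infinitely many degrees.
\<close>
lemma D_alg_zero_of_kills_degree_sequence: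
  assumes "L \<in> D_alg \<beta>"
    and Q: "\<And>n. n \<ge> n0 \<Longrightarrow> degree (Q n) = n \<and> Q n \<noteq> 0 \<and> L (Q n) = 0"
  shows "L p = 0"
proof -
  obtain R c where L: "\<And>p j. coeff (L p) j = (\<Sum>d\<le>R. poly (c d) (real (j + d)) * coeff p (j + d))"
    using D_alg_shift_form[OF assms(1)] unfolding shift_form_def by blast
  have "d \<le> R \<Longrightarrow> c d = 0" for d
  proof (induction d rule: less_induct)
    case (less d)
    show ?case
    proof (rule poly_zero_of_eventually_zero_on_nat[of "n0 + d"])
      fix n assume n: "n \<ge> n0 + d"
      have "0 = (\<Sum>e\<le>R. poly (c e) (real (n - d + e)) * coeff (Q n) (n - d + e))"
        using Q[of n] n L[of "Q n" "n - d"] by simp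
      also have "\<dots> = (\<Sum>e\<le>R. if e = d then poly (c d) (real n) * coeff (Q n) n else 0)"
      proof (rule sum.cong[OF refl])
        fix e assume "e \<in> {..R}"
        then show "poly (c e) (real (n - d + e)) * coeff (Q n) (n - d + e)
            = (if e = d then poly (c d) (real n) * coeff (Q n) n else 0)"
          using less.IH[of e] n Q[of n]
          by (cases e d rule: linorder_cases) (auto simp: coeff_eq_0)
      qed
      also have "\<dots> = poly (c d) (real n) * coeff (Q n) n" using less.prems by simp
      finally show "poly (c d) (real n) = 0"
        using Q[of n] n by (metis add_leD1 leading_coeff_0_iff mult_eq_0_iff)
    qed
  qed
  then show ?thesis by (intro poly_eqI) (simp add: L)
qed

section \<open>The generators in the basis of Jacobi polynomials\<close>

lemma coeff_jacobi:
  "coeff (jacobi a b (int n)) m =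
     (-1) ^ n * pochhammer (a + b + 1) n / fact n *
     (pochhammer (- real n) m * pochhammer (real n + a + b + 1) m / (pochhammer (b + 1) m * fact m))"
proof (cases "m \<le> n")
  case True
  then show ?thesis by (simp add: jacobi_def coeff_sum)
next
  case False
  then have "pochhammer (- real n) m = 0" by (simp add: pochhammer_of_nat_eq_0_lemma)
  with False show ?thesis by (simp add: jacobi_def coeff_sum)
qed

lemma coeff_jacobi_Suc:
  assumes "b + 1 + real m \<noteq> 0"
  shows "(real m + 1) * (real m + 1 + b) * coeff (jacobi a b (int n)) (Suc m)
     = (real m - real n) * (real n + real m + a + b + 1) * coeff (jacobi a b (int n)) m"
proof (cases "pochhammer (b + 1) m = 0")
  case True
  then show ?thesis by (simp add: coeff_jacobi pochhammer_Suc)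
next
  case False
  then show ?thesis using assms
    by (simp add: coeff_jacobi pochhammer_Suc divide_simps)
       (simp add: algebra_simps)
qed

text \<open>
Coefficientwise, this is \<open>D1 (p (n + 1) - p n) = (n + 1) p (n + 1) + (n + a + b + 1) p n\<close>.
Induction on \<open>m\<close> through \<open>coeff_jacobi_Suc\<close> treats \<open>m \<le> n\<close> and \<open>m > n\<close> alike, whereas the
quotient \<open>pochhammer (- n) m / fact n\<close> behaves differently in the two ranges.
\<close>
lemma coeff_jacobi_raise_index:
  assumes b: "\<And>m::nat. 1 \<le> m \<Longrightarrow> b \<noteq> - real m"
  shows "(real n + 1 - real m) * coeff (jacobi a b (int (Suc n))) m
     = - (real m + real n + a + b + 1) * coeff (jacobi a b (int n)) m"
proof (induction m)
  case 0
  show ?case unfolding coeff_jacobi by (simp add: pochhammer_Suc divide_simps) (simp add: algebra_simps)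
next
  case (Suc m)
  define K where "K = (real m + 1) * (real m + 1 + b)"
  define S where "S = a + b + 1"
  have nz: "b + 1 + real m \<noteq> 0" using b[of "Suc m"] by auto
  then have K: "K \<noteq> 0" by (simp add: K_def add_ac)
  let ?c = "\<lambda>n m. coeff (jacobi a b (int n)) m"
  have 1: "K * ?c (Suc n) (Suc m) = (real m - real n - 1) * (real n + 1 + real m + S) * ?c (Suc n) m"
    using coeff_jacobi_Suc[OF nz, of a "Suc n"] by (simp add: K_def S_def algebra_simps)
  have 2: "K * ?c n (Suc m) = (real m - real n) * (real n + real m + S) * ?c n m"
    using coeff_jacobi_Suc[OF nz, of a n] by (simp add: K_def S_def algebra_simps)
  have 3: "(real n + 1 - real m) * ?c (Suc n) m = - (real m + real n + S) * ?c n m"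
    using Suc.IH by (simp add: S_def algebra_simps)
  have "K * ((real n - real m) * ?c (Suc n) (Suc m)) = K * (- (real m + 1 + real n + S) * ?c n (Suc m))"
  proof -
    have "K * ((real n - real m) * ?c (Suc n) (Suc m))
        = (real n - real m) * ((real m - real n - 1) * (real n + 1 + real m + S) * ?c (Suc n) m)"
      unfolding 1[symmetric] by (rule mult.left_commute)
    also have "\<dots> = (real n - real m) * (real n + 1 + real m + S) * - ((real n + 1 - real m) * ?c (Suc n) m)"
      by (simp add: algebra_simps)
    also have "\<dots> = - (real m + 1 + real n + S) * (K * ?c n (Suc m))"
      unfolding 3 2 by (simp add: algebra_simps)
    finally show ?thesis by (simp add: mult_ac)
  qed
  then have "(real n - real m) * ?c (Suc n) (Suc m) = - (real m + 1 + real n + S) * ?c n (Suc m)"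
    by (simp only: mult_left_cancel[OF K])
  then show ?case by (simp add: S_def algebra_simps)
qed

text \<open>
Summing the preceding two-term relation over the indices up to \<open>n\<close> shows that \<open>D1\<close> acts by
partial sums. The weight \<open>2 j + a + b + 1\<close> changes sign under
\<open>j \<mapsto> - j - (a + b + 1)\<close>, and it divides every polynomial that does.
\<close>
lemma D1_jacobi:
  assumes b: "\<And>m::nat. 1 \<le> m \<Longrightarrow> b \<noteq> - real m"
  shows "D1 (jacobi a b (int n)) = smult (real n) (jacobi a b (int n))
     + (\<Sum>j<n. smult (2 * real j + a + b + 1) (jacobi a b (int j)))"
proof (induction n)
  case 0
  show ?case by (simp add: jacobi_def D1_def pderiv_smult pderiv_monom)
next
  case (Suc n)
  let ?p = "\<lambda>n. jacobi a b (int n)"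
  have D1: "coeff (D1 p) m = real m * coeff p m" for p m
    by (cases m) (simp_all add: D1_def coeff_pderiv)
  have "D1 (?p (Suc n)) - D1 (?p n) = smult (real n + 1) (?p (Suc n)) + smult (real n + a + b + 1) (?p n)"
  proof (rule poly_eqI)
    fix m
    show "coeff (D1 (?p (Suc n)) - D1 (?p n)) m
        = coeff (smult (real n + 1) (?p (Suc n)) + smult (real n + a + b + 1) (?p n)) m"
      using coeff_jacobi_raise_index[OF b, where n = n and m = m and a = a] by (simp add: D1 algebra_simps)
  qed
  then have "D1 (?p (Suc n)) = smult (real n + 1) (?p (Suc n)) + smult (real n + a + b + 1) (?p n) + D1 (?p n)"
    by (simp add: algebra_simps)
  then show ?case unfolding Suc.IH by (simp add: algebra_simps smult_add_left[symmetric])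
qed

text \<open>
The hypergeometric operator \<open>z (z - 1) \<partial>\<^sup>2 + ((s + 2) z - b - 1) \<partial>\<close>, written in terms of the two
generators; the sign is chosen to make its eigenvalues \<open>lam s n\<close>.
\<close>
definition Lam :: "real \<Rightarrow> real \<Rightarrow> real poly \<Rightarrow> real poly" where
  "Lam s b p = D1 (D1 p) + smult (s + 1) (D1 p) - D2 b p"

lemma Lam_in_D_alg: "Lam s \<beta> \<in> D_alg \<beta>"
  unfolding Lam_def
  by (intro D_alg_minus D_alg_add D_alg_smult D_alg_comp[OF D1_in_D_alg D1_in_D_alg] D1_in_D_alg D2_in_D_alg)

lemma Lam_jacobi:
  assumes b: "\<And>m::nat. 1 \<le> m \<Longrightarrow> b \<noteq> - real m"
  shows "Lam (a + b) b (jacobi a b (int n)) = smult (lam (a + b) (real n)) (jacobi a b (int n))"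
proof (rule poly_eqI)
  fix m
  have D1: "coeff (D1 p) m = real m * coeff p m" for p m
    by (cases m) (simp_all add: D1_def coeff_pderiv)
  have D2: "coeff (D2 b p) m = (real m + 1) * (real m + 1 + b) * coeff p (Suc m)" for p
    by (cases m) (simp_all add: D2_def coeff_pderiv algebra_simps)
  have nz: "b + 1 + real m \<noteq> 0" using b[of "Suc m"] by auto
  show "coeff (Lam (a + b) b (jacobi a b (int n))) m = coeff (smult (lam (a + b) (real n)) (jacobi a b (int n))) m"
    by (simp add: Lam_def D1 D2 coeff_jacobi_Suc[OF nz] lam_def) (simp add: algebra_simps)
qed

lemma jacobi_degree:
  assumes S: "\<And>m::nat. a + b + 1 + real m \<noteq> 0"
    and b: "\<And>m::nat. 1 \<le> m \<Longrightarrow> b \<noteq> - real m"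
  shows "coeff (jacobi a b (int n)) n \<noteq> 0" and "degree (jacobi a b (int n)) \<le> n"
proof -
  have 1: "pochhammer (a + b + 1) n \<noteq> 0"
  proof
    assume "pochhammer (a + b + 1) n = 0"
    then obtain m where "a + b + 1 = - real m" by (auto simp: pochhammer_eq_0_iff)
    with S[of m] show False by simp
  qed
  have 2: "pochhammer (real n + a + b + 1) n \<noteq> 0"
  proof
    assume "pochhammer (real n + a + b + 1) n = 0"
    then obtain m where "real n + a + b + 1 = - real m" by (auto simp: pochhammer_eq_0_iff)
    with S[of "n + m"] show False by simp
  qed
  have 3: "pochhammer (b + 1) n \<noteq> 0"
  proof
    assume "pochhammer (b + 1) n = 0"
    then obtain m where "b + 1 = - real m" by (auto simp: pochhammer_eq_0_iff)
    with b[of "Suc m"] show False by simp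
  qed
  have 4: "pochhammer (- real n) n \<noteq> 0"
    by (metis dual_order.refl pochhammer_of_nat_eq_0_lemma')
  show "coeff (jacobi a b (int n)) n \<noteq> 0" using 1 2 3 4 by (simp add: coeff_jacobi)
  show "degree (jacobi a b (int n)) \<le> n"
    by (rule degree_le) (simp add: coeff_jacobi pochhammer_of_nat_eq_0_lemma)
qed

section \<open>Reflection-invariant polynomials and partial-sum operators\<close>

lemma poly_eq_of_values:
  fixes p r :: "real poly"
  assumes "\<And>x. poly p x = poly r x"
  shows "p = r"
  using assms poly_eq_poly_eq_iff by blast

lemma even_poly_in_square:
  fixes p :: "real poly"
  assumes "\<And>x. poly p (- x) = poly p x"
  shows "\<exists>r. \<forall>x. poly p x = poly r (x\<^sup>2)"
  using assms
proof (induction "degree p" arbitrary: p rule: less_induct)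
  case less
  show ?case
  proof (cases "degree p = 0")
    case True
    then obtain c where "p = [:c:]" by (metis degree_eq_zeroE)
    then show ?thesis by (intro exI[of _ "[:c:]"]) simp
  next
    case False
    obtain c p1 where p: "p = pCons c p1" by (cases p)
    have "pCons 0 (p1 + p1 \<circ>\<^sub>p [:0, -1:]) = 0"
    proof (rule poly_eq_of_values)
      fix x show "poly (pCons 0 (p1 + p1 \<circ>\<^sub>p [:0, -1:])) x = poly 0 x"
        using less.prems[of x] by (simp add: p poly_pcompose algebra_simps)
    qed
    then have "p1 + p1 \<circ>\<^sub>p [:0, -1:] = 0" by simp
    then have "poly (p1 + p1 \<circ>\<^sub>p [:0, -1:]) x = 0" for x by simp
    then have odd: "poly p1 x + poly p1 (- x) = 0" for x by (simp add: poly_pcompose)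
    from odd[of 0] have "poly p1 0 = 0" by simp
    then obtain p2 where p1: "p1 = pCons 0 p2" by (cases p1) auto
    have "pCons 0 (p2 - p2 \<circ>\<^sub>p [:0, -1:]) = 0"
    proof (rule poly_eq_of_values)
      fix x show "poly (pCons 0 (p2 - p2 \<circ>\<^sub>p [:0, -1:])) x = poly 0 x"
        using odd[of x] by (simp add: p1 poly_pcompose algebra_simps)
    qed
    then have p2: "p2 = p2 \<circ>\<^sub>p [:0, -1:]" by simp
    have "poly p2 x = poly (p2 \<circ>\<^sub>p [:0, -1:]) x" for x using arg_cong[OF p2, of "\<lambda>p. poly p x"] .
    then have "poly p2 (- x) = poly p2 x" for x by (simp add: poly_pcompose)
    moreover have "degree p2 < degree p" using False p p1 by (simp split: if_splits)
    ultimately obtain r where r: "\<forall>x. poly p2 x = poly r (x\<^sup>2)" using less.hyps by blast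
    then show ?thesis
      by (intro exI[of _ "pCons c r"]) (simp add: p p1 power2_eq_square mult.assoc)
  qed
qed

text \<open>
The reflection \<open>x \<mapsto> - x - (s + 1)\<close> has the fixed point \<open>- (s + 1) / 2\<close>, and \<open>lam s x\<close> is, up to a
constant, the square of the distance from it.
\<close>
lemma reflection_invariant_poly:
  assumes "\<And>x. poly p (- x - (s + 1)) = poly p (x::real)"
  shows "\<exists>r. \<forall>x. poly p x = poly r (lam s x)"
proof -
  let ?p = "p \<circ>\<^sub>p [:- (s + 1) / 2, 1:]"
  have "poly ?p (- x) = poly ?p x" for x
    using assms[of "x - (s + 1) / 2"] by (simp add: poly_pcompose field_simps)
  then obtain r where r: "\<forall>x. poly ?p x = poly r (x\<^sup>2)" using even_poly_in_square by blast
  have "poly p x = poly (r \<circ>\<^sub>p [:((s + 1) / 2)\<^sup>2, 1:]) (lam s x)" for x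
    using r[rule_format, of "x + (s + 1) / 2"]
    by (simp add: poly_pcompose lam_def power2_eq_square field_simps)
  then show ?thesis by blast
qed

lemma reflection_antiinvariant_poly:
  assumes "\<And>x. poly p (- x - (s + 1)) = - poly p (x::real)"
  shows "\<exists>r. \<forall>x. poly p x = (2 * x + s + 1) * poly r (lam s x)"
proof -
  define x0 where "x0 = - (s + 1) / 2"
  have x0: "- x0 - (s + 1) = x0" by (simp add: x0_def field_simps)
  have "poly p x0 = 0" using assms[of x0] unfolding x0 by simp
  then have "[:- x0, 1:] dvd p" by (simp only: poly_eq_0_iff_dvd)
  moreover have "- x0 = (s + 1) / 2" unfolding x0_def by (simp add: field_simps)
  ultimately have "[:(s + 1) / 2, 1:] dvd p" by simp
  then obtain p1 where p: "p = [:(s + 1) / 2, 1:] * p1" by (elim dvdE)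
  have "poly p1 (- x - (s + 1)) = poly p1 x" for x
  proof (cases "x + (s + 1) / 2 = 0")
    case True
    then have x: "- x - (s + 1) = x" by (simp add: field_simps)
    show ?thesis unfolding x ..
  next
    case False
    have "(x + (s + 1) / 2) * poly p1 (- x - (s + 1)) = (x + (s + 1) / 2) * poly p1 x"
      using assms[of x] by (simp add: p field_simps)
    with False show ?thesis by simp
  qed
  from reflection_invariant_poly[OF this] obtain r where "\<forall>x. poly p1 x = poly r (lam s x)" by blast
  then have "poly p x = (2 * x + s + 1) * poly (smult (1/2) r) (lam s x)" for x
    by (simp add: p field_simps)
  then show ?thesis by blast
qed

context
  fixes a b :: real
  assumes b: "\<And>m::nat. 1 \<le> m \<Longrightarrow> b \<noteq> - real m"
begin

lemma poly_of_eigenvalue_in_D_alg: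
  "\<exists>L \<in> D_alg b. \<forall>n::nat. L (jacobi a b (int n))
     = smult (poly r (lam (a + b) (real n))) (jacobi a b (int n))"
proof (induction r)
  case 0
  show ?case by (rule bexI[OF _ D_alg_smult[OF D_alg_id, of 0]]) simp
next
  case (pCons c r)
  then obtain L where L: "L \<in> D_alg b"
    "\<And>n::nat. L (jacobi a b (int n)) = smult (poly r (lam (a + b) (real n))) (jacobi a b (int n))" by blast
  show ?case
  proof (rule bexI)
    show "(\<lambda>p. smult c (id p) + Lam (a + b) b (L p)) \<in> D_alg b"
      by (intro D_alg_add D_alg_smult D_alg_id D_alg_comp[OF Lam_in_D_alg L(1)])
    show "\<forall>n::nat. smult c (id (jacobi a b (int n))) + Lam (a + b) b (L (jacobi a b (int n)))
        = smult (poly (pCons c r) (lam (a + b) (real n))) (jacobi a b (int n))"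
      by (simp add: L(2) D_alg_linear(2)[OF Lam_in_D_alg] Lam_jacobi[OF b] smult_add_left mult.commute)
  qed
qed

lemma invariant_poly_in_D_alg:
  assumes "\<And>x. poly p (- x - (a + b + 1)) = poly p x"
  shows "\<exists>L \<in> D_alg b. \<forall>n::nat. L (jacobi a b (int n)) = smult (poly p (real n)) (jacobi a b (int n))"
proof -
  obtain r where "\<forall>x. poly p x = poly r (lam (a + b) x)"
    using reflection_invariant_poly[of p "a + b", OF assms] by blast
  then show ?thesis using poly_of_eigenvalue_in_D_alg[of r] by simp
qed

text \<open>
The operator \<open>D1 + (a + b + 1) / 2\<close> is the case \<open>g = 1\<close>, \<open>h x = 2 x + a + b + 1\<close>. Applying
a polynomial in \<open>Lam\<close> before it multiplies the result by an invariant function of \<open>n\<close>; applying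
one after it multiplies the weight at \<open>j\<close> by such a function of \<open>j\<close>. This reaches all
anti-invariant weights.
\<close>
lemma partial_sum_operator_in_D_alg:
  assumes h: "\<And>x. poly h (- x - (a + b + 1)) = - poly h x"
    and g: "\<And>x. poly g (- x - (a + b + 1)) = poly g x"
  shows "\<exists>L \<in> D_alg b. \<forall>n::nat. L (jacobi a b (int n)) = smult (poly g (real n))
     (smult (poly h (real n) / 2) (jacobi a b (int n))
       + (\<Sum>j<n. smult (poly h (real j)) (jacobi a b (int j))))"
proof -
  obtain r where r: "\<And>x. poly h x = (2 * x + (a + b) + 1) * poly r (lam (a + b) x)"
    using reflection_antiinvariant_poly[of h "a + b", OF h] by blast
  obtain R where R: "R \<in> D_alg b"
    "\<And>n::nat. R (jacobi a b (int n)) = smult (poly r (lam (a + b) (real n))) (jacobi a b (int n))"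
    using poly_of_eigenvalue_in_D_alg by blast
  obtain Q where Q: "Q \<in> D_alg b"
    "\<And>n::nat. Q (jacobi a b (int n)) = smult (poly g (real n)) (jacobi a b (int n))"
    using invariant_poly_in_D_alg[OF g] by blast
  show ?thesis
  proof (rule bexI, rule allI)
    show "(\<lambda>p. R (D1 (Q p) + smult ((a + b + 1) / 2) (Q p))) \<in> D_alg b"
      by (rule D_alg_comp[OF R(1) D_alg_add[OF D_alg_comp[OF D1_in_D_alg Q(1)] D_alg_smult[OF Q(1)]]])
    fix n :: nat
    let ?P = "\<lambda>n. jacobi a b (int n)"
    note lin = D_alg_linear[OF R(1)] D_alg_linear[OF D1_in_D_alg] D_alg_sum[OF R(1)]
    have "R (D1 (Q (?P n)) + smult ((a + b + 1) / 2) (Q (?P n)))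
       = smult (poly g (real n)) (smult ((real n + (a + b + 1) / 2) * poly r (lam (a + b) (real n))) (?P n)
           + (\<Sum>j<n. smult ((2 * real j + a + b + 1) * poly r (lam (a + b) (real j))) (?P j)))"
      by (simp add: Q R lin D1_jacobi[OF b] smult_add_right smult_add_left[symmetric] algebra_simps)
    also have "\<dots> = smult (poly g (real n))
     (smult (poly h (real n) / 2) (?P n) + (\<Sum>j<n. smult (poly h (real j)) (?P j)))"
      unfolding r by (simp add: field_simps)
    finally show "R (D1 (Q (?P n)) + smult ((a + b + 1) / 2) (Q (?P n))) = \<dots>" .
  qed
qed

text \<open>
Each partial-sum operator brings the diagonal term \<open>f l * H l / 2\<close>, which is anti-invariant.
The diagonal \<open>U\<close> is therefore not free: after subtracting these terms it must be invariant,
since only invariant diagonals come from polynomials in \<open>Lam\<close>.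
\<close>
lemma perturbed_operator_in_D_alg:
  assumes H: "\<And>l x. l < k \<Longrightarrow> poly (H l) (- x - (a + b + 1)) = - poly (H l) x"
    and f: "\<And>l x. l < k \<Longrightarrow> poly (f l) (- x - (a + b + 1)) = poly (f l) x"
    and V: "\<And>x. poly V (- x - (a + b + 1)) = poly V x"
    and U: "\<And>x. poly U x = poly V x + (\<Sum>l<k. poly (f l) x * poly (H l) x) / 2"
  shows "\<exists>L \<in> D_alg b. \<forall>n::nat. L (jacobi a b (int n)) = smult (poly U (real n)) (jacobi a b (int n))
     + (\<Sum>l<k. smult (poly (f l) (real n)) (\<Sum>j<n. smult (poly (H l) (real j)) (jacobi a b (int j))))"
proof -
  obtain L0 where L0: "L0 \<in> D_alg b"
    "\<And>n::nat. L0 (jacobi a b (int n)) = smult (poly V (real n)) (jacobi a b (int n))"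
    using invariant_poly_in_D_alg[OF V] by blast
  let ?X = "\<lambda>l L. L \<in> D_alg b \<and> (\<forall>n::nat. L (jacobi a b (int n)) = smult (poly (f l) (real n))
     (smult (poly (H l) (real n) / 2) (jacobi a b (int n))
       + (\<Sum>j<n. smult (poly (H l) (real j)) (jacobi a b (int j)))))"
  have "\<exists>L. ?X l L" if "l < k" for l
    using partial_sum_operator_in_D_alg[OF H[OF that] f[OF that]] by (elim bexE) (rule exI, rule conjI)
  then have "\<forall>l. \<exists>L. l < k \<longrightarrow> ?X l L" by blast
  from choice[OF this] obtain L where L: "\<And>l. l < k \<Longrightarrow> L l \<in> D_alg b"
    "\<And>l n. l < k \<Longrightarrow> L l (jacobi a b (int n)) = smult (poly (f l) (real n))
     (smult (poly (H l) (real n) / 2) (jacobi a b (int n))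
       + (\<Sum>j<n. smult (poly (H l) (real j)) (jacobi a b (int j))))" by blast
  show ?thesis
  proof (rule bexI, rule allI)
    show "(\<lambda>p. L0 p + (\<Sum>l<k. L l p)) \<in> D_alg b"
      by (rule D_alg_add[OF L0(1) D_alg_sum_closed[OF L(1)]]) simp
    fix n :: nat
    have "(\<Sum>l<k. L l (jacobi a b (int n)))
       = (\<Sum>l<k. smult (poly (f l) (real n) * poly (H l) (real n) / 2) (jacobi a b (int n)))
        + (\<Sum>l<k. smult (poly (f l) (real n)) (\<Sum>j<n. smult (poly (H l) (real j)) (jacobi a b (int j))))"
      unfolding sum.distrib[symmetric] by (rule sum.cong) (simp_all add: L(2) smult_add_right)
    then show "L0 (jacobi a b (int n)) + (\<Sum>l<k. L l (jacobi a b (int n)))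
       = smult (poly U (real n)) (jacobi a b (int n))
     + (\<Sum>l<k. smult (poly (f l) (real n)) (\<Sum>j<n. smult (poly (H l) (real j)) (jacobi a b (int j))))"
      by (simp add: L0 U smult_add_left smult_sum sum_divide_distrib)
  qed
qed

end

section \<open>The functions psi and their Wronskian\<close>

lemma poly_pochhammer: "poly (pochhammer p j) x = pochhammer (poly p x) j"
  by (induction j) (simp_all add: pochhammer_Suc)

text \<open>
The Pochhammer symbols come in pairs of equal length, and the reflection interchanges the two
symbols of a pair. For the pair of length \<open>\<alpha>\<close> this is so after reversing the order of the
factors in each symbol, and the resulting sign \<open>(-1)^\<alpha>\<close> appears twice.
\<close>
lemma psi_reflect:
  "poly (psi \<alpha> \<beta> a j) (- x - (real \<alpha> + \<beta> + 1)) = poly (psi \<alpha> \<beta> a j) x"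
proof -
  let ?y = "- x - (real \<alpha> + \<beta> + 1)"
  have 1: "poly (phi1 \<alpha> \<beta> l) ?y = poly (phi1 \<alpha> \<beta> l) x" for l
  proof -
    have "poly [:1, 1:] ?y = poly [:- real \<alpha> - \<beta>, -1:] x" "poly [:- real \<alpha> - \<beta>, -1:] ?y = poly [:1, 1:] x"
      by simp_all
    then show ?thesis
      by (simp only: phi1_def poly_smult poly_mult poly_pochhammer mult.commute)
  qed
  have "pochhammer (1 + ?y) \<alpha> = (-1) ^ \<alpha> * pochhammer (\<beta> + 1 + x) \<alpha>"
    using pochhammer_minus[of "x + real \<alpha> + \<beta>" \<alpha>] by (simp add: algebra_simps)
  moreover have "pochhammer (\<beta> + 1 + ?y) \<alpha> = (-1) ^ \<alpha> * pochhammer (1 + x) \<alpha>"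
    using pochhammer_minus[of "x + real \<alpha>" \<alpha>] by (simp add: algebra_simps)
  ultimately have "pochhammer (1 + ?y) \<alpha> * pochhammer (\<beta> + 1 + ?y) \<alpha>
      = pochhammer (1 + x) \<alpha> * pochhammer (\<beta> + 1 + x) \<alpha>"
    by (simp add: power_mult_distrib[symmetric] mult_ac)
  moreover have "pochhammer (- ?y) j * pochhammer (real \<alpha> + \<beta> + 1 + ?y) j
      = pochhammer (- x) j * pochhammer (real \<alpha> + \<beta> + 1 + x) j"
    by (simp add: algebra_simps)
  ultimately have "pochhammer (1 + ?y) \<alpha> * pochhammer (\<beta> + 1 + ?y) \<alpha> *
        (pochhammer (- ?y) j * pochhammer (real \<alpha> + \<beta> + 1 + ?y) j)
      = pochhammer (1 + x) \<alpha> * pochhammer (\<beta> + 1 + x) \<alpha> *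
        (pochhammer (- x) j * pochhammer (real \<alpha> + \<beta> + 1 + x) j)"
    by (rule arg_cong2[where f = "(*)"])
  then have "poly (phi2 \<alpha> \<beta> j) ?y = poly (phi2 \<alpha> \<beta> j) x"
    unfolding phi2_def poly_smult poly_mult poly_pochhammer by (simp add: mult.assoc)
  with 1 show ?thesis by (simp add: psi_def poly_sum)
qed

lemma degree_pochhammer_linear:
  assumes "(u::real) \<noteq> 0"
  shows "degree (pochhammer [:c, u:] j) = j" and "pochhammer [:c, u:] j \<noteq> 0"
proof (induction j)
  case (Suc j)
  have e: "pochhammer [:c, u:] (Suc j) = pochhammer [:c, u:] j * [:c + real j, u:]"
    by (simp only: pochhammer_Suc) (simp add: of_nat_poly)
  have nz: "[:c + real j, u:] \<noteq> 0" using assms by simp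
  { case 1
    show ?case unfolding e degree_mult_eq[OF Suc(2) nz] using Suc(1) assms by simp
  next
    case 2
    show ?case unfolding e using Suc(2) nz by (simp only: mult_eq_0_iff) simp }
qed simp_all

text \<open>
The summands from \<open>phi1\<close> have degree at most \<open>2 j < 2 \<alpha>\<close>, so \<open>phi2\<close> decides. This makes the
degrees distinct for every choice of \<open>a\<close>.
\<close>
lemma degree_psi:
  assumes "k \<le> \<alpha>" "j < k" and \<beta>: "\<And>m::nat. 1 \<le> m \<Longrightarrow> \<beta> \<noteq> - real m"
  shows "degree (psi \<alpha> \<beta> a j) = 2 * \<alpha> + 2 * j"
proof -
  have nz: "pochhammer (1 + real \<alpha>) j \<noteq> 0" "pochhammer (1 + \<beta>) \<alpha> \<noteq> 0"
  proof -
    show "pochhammer (1 + real \<alpha>) j \<noteq> 0" by (simp add: pochhammer_pos less_imp_neq[symmetric] add_pos_nonneg)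
    show "pochhammer (1 + \<beta>) \<alpha> \<noteq> 0"
    proof
      assume "pochhammer (1 + \<beta>) \<alpha> = 0"
      then obtain m where "1 + \<beta> = - real m" by (auto simp: pochhammer_eq_0_iff)
      with \<beta>[of "Suc m"] show False by simp
    qed
  qed
  note d = degree_pochhammer_linear
  have 2: "degree (phi2 \<alpha> \<beta> j) = 2 * \<alpha> + 2 * j"
    using nz by (simp add: phi2_def degree_mult_eq d)
  have "degree (phi1 \<alpha> \<beta> l) \<le> 2 * j" if "l \<le> j" for l
  proof -
    have "degree (phi1 \<alpha> \<beta> l) \<le> degree (pochhammer [:1, 1:] l * pochhammer [:- real \<alpha> - \<beta>, -1:] l)"
      unfolding phi1_def by (rule degree_smult_le)
    also have "\<dots> = 2 * l" by (simp add: degree_mult_eq d)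
    finally show ?thesis using that by simp
  qed
  then have "degree (\<Sum>l\<le>j. smult (a (j - l)) (phi1 \<alpha> \<beta> l)) \<le> 2 * j"
    by (intro degree_sum_le) (auto intro: order.trans[OF degree_smult_le])
  with 2 assms show ?thesis by (simp add: psi_def degree_add_eq_right)
qed

lemma tau_eq_det_casorati: "tau \<alpha> \<beta> k a = det (casorati k (psi \<alpha> \<beta> a))"
  unfolding tau_def Wr_def casorati_def
  by (rule arg_cong[where f = det]) auto

lemma tau_nonzero:
  assumes "0 < \<alpha>" "k \<le> \<alpha>" and \<beta>: "\<And>m::nat. 1 \<le> m \<Longrightarrow> \<beta> \<noteq> - real m"
  shows "tau \<alpha> \<beta> k a \<noteq> 0"
  unfolding tau_eq_det_casorati
proof (rule det_casorati_nonzero, rule increasing_degree_independent)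
  note deg = degree_psi[OF assms(2) _ \<beta>]
  show "degree (psi \<alpha> \<beta> a i) < degree (psi \<alpha> \<beta> a j)" if "i < j" "j < k" for i j
    using that deg by simp
  show "psi \<alpha> \<beta> a l \<noteq> 0" if "l < k" for l
    using deg[OF that, of a] \<open>0 < \<alpha>\<close> by auto
qed

section \<open>Kernels supported on windows\<close>

lemma smult_sum_right: "smult c (sum p I) = (\<Sum>i\<in>I. smult c (p i))"
  by (induction I rule: infinite_finite_induct) (simp_all add: smult_add_right)

text \<open>
The window with top \<open>t\<close> consists of the points \<open>t, t - 1, \<dots>, t - (k - 1)\<close>, and
\<open>\<kappa> _ j t\<close> is, up to the factor \<open>G (t + 1)\<close>, the functional that picks the \<open>j\<close>-th
point of it. With \<open>N = x - m\<close>, the functional in the statement is minus the sum, over the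
\<open>k\<close> windows that contain \<open>N\<close>, of those that pick \<open>N\<close>. If the top of such a window is at least \<open>x\<close>,
that is \<open>j \<ge> m\<close>, the window also contains all the points \<open>x - i\<close> with \<open>i < m\<close>, so this
window contributes \<open>0\<close>. Otherwise the relation \<open>ann\<close> trades these points for the points
\<open>x - i\<close> with \<open>i \<ge> m\<close>, which lie in the window, and only \<open>i = m\<close> contributes.
\<close>
lemma window_functional_identity:
  fixes f :: "nat \<Rightarrow> real \<Rightarrow> real" and \<kappa> :: "nat \<Rightarrow> nat \<Rightarrow> real \<Rightarrow> real"
  assumes ann: "\<And>l. l < k \<Longrightarrow> (\<Sum>i\<le>k. C i * f l (x - real i)) = 0"
    and \<kappa>: "\<And>t j j'. j < k \<Longrightarrow> j' < k \<Longrightarrow>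
      (\<Sum>l<k. \<kappa> l j t * f l (t - real j')) = (if j = j' then G (t + 1) else 0)"
    and m: "m \<le> k"
  shows "(\<Sum>l<k. - (\<Sum>j<k. \<kappa> l j (x - real m + real j)) * (\<Sum>i<m. C i * f l (x - real i)))
     = C m * (\<Sum>r<m. G (x - real r))"
proof -
  define N where "N = x - real m"
  define A where "A j = (\<Sum>l<k. \<kappa> l j (N + real j) * (\<Sum>i<m. C i * f l (x - real i)))" for j
  have swap: "(\<Sum>l<k. \<kappa> l j t * (\<Sum>i\<in>I. C i * f l (x - real i)))
      = (\<Sum>i\<in>I. C i * (\<Sum>l<k. \<kappa> l j t * f l (x - real i)))" for j t I
    by (simp add: sum_distrib_left mult_ac) (rule sum.swap)
  have "A j = (if j < m then - C m * G (N + real j + 1) else 0)" if j: "j < k" for j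
  proof (cases "j < m")
    case False
    have "(\<Sum>l<k. \<kappa> l j (N + real j) * f l (x - real i)) = 0" if "i < m" for i
    proof -
      have e: "x - real i = N + real j - real (j - m + i)" using False by (simp add: N_def)
      show ?thesis unfolding e using \<kappa>[of j "j - m + i" "N + real j"] False j that by simp
    qed
    then show ?thesis using False by (simp add: A_def swap)
  next
    case True
    have "(\<Sum>i<m. C i * f l (x - real i)) = - (\<Sum>i\<in>{m..k}. C i * f l (x - real i))" if "l < k" for l
    proof -
      have "{..k} = {..<m} \<union> {m..k}" using m by auto
      moreover have "(\<Sum>i\<in>{..<m} \<union> {m..k}. C i * f l (x - real i))
         = (\<Sum>i<m. C i * f l (x - real i)) + (\<Sum>i\<in>{m..k}. C i * f l (x - real i))"
        by (rule sum.union_disjoint) auto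
      ultimately show ?thesis using ann[OF that] by simp
    qed
    then have "A j = (\<Sum>l<k. - (\<kappa> l j (N + real j) * (\<Sum>i\<in>{m..k}. C i * f l (x - real i))))"
      by (simp add: A_def)
    also have "\<dots> = - (\<Sum>i\<in>{m..k}. C i * (\<Sum>l<k. \<kappa> l j (N + real j) * f l (x - real i)))"
      by (simp add: sum_negf swap)
    also have "(\<Sum>i\<in>{m..k}. C i * (\<Sum>l<k. \<kappa> l j (N + real j) * f l (x - real i)))
       = (\<Sum>i\<in>{m..k}. if i = m then C m * G (N + real j + 1) else 0)"
    proof (rule sum.cong[OF refl])
      fix i assume i: "i \<in> {m..k}"
      have e: "x - real i = N + real j - real (j + i - m)" using i by (simp add: N_def of_nat_diff)
      have "j + i - m < k" using i j True by auto
      from \<kappa>[OF j this, of "N + real j"] show "C i * (\<Sum>l<k. \<kappa> l j (N + real j) * f l (x - real i))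
          = (if i = m then C m * G (N + real j + 1) else 0)"
        unfolding e using i by auto
    qed
    also have "\<dots> = C m * G (N + real j + 1)" using m by simp
    finally show ?thesis using True by simp
  qed
  then have "(\<Sum>j<k. A j) = (\<Sum>j<k. if j < m then - C m * G (N + real j + 1) else 0)" by simp
  also have "\<dots> = (\<Sum>j<m. - C m * G (N + real j + 1))"
    using m by (intro sum.mono_neutral_cong_right) auto
  also have "\<dots> = (\<Sum>r<m. - C m * G (x - real r))"
    by (subst sum.nat_diff_reindex[symmetric], rule sum.cong) (auto simp: N_def of_nat_diff)
  finally have "(\<Sum>j<k. A j) = - (C m * (\<Sum>r<m. G (x - real r)))"
    by (simp add: sum_distrib_left sum_negf)
  moreover have "(\<Sum>l<k. - (\<Sum>j<k. \<kappa> l j (N + real j)) * (\<Sum>i<m. C i * f l (x - real i))) = - (\<Sum>j<k. A j)"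
    unfolding A_def by (simp add: sum_distrib_right sum_negf) (rule sum.swap)
  ultimately show ?thesis by (simp add: N_def)
qed

lemma reindex_downwards:
  assumes "\<And>j. j < 0 \<Longrightarrow> P j = (0::real poly)"
  shows "(\<Sum>j<n - i. smult (h (real j)) (P (int j)))
     = (\<Sum>m\<le>n. smult (if i < m then h (real n - real m) else 0) (P (int n - int m)))"
proof -
  have "(\<Sum>j<n - i. smult (h (real j)) (P (int j)))
      = (\<Sum>m\<in>{i<..n}. smult (h (real n - real m)) (P (int n - int m)))"
    by (rule sum.reindex_bij_witness[of _ "\<lambda>m. n - m" "\<lambda>j. n - j"]) (auto simp: of_nat_diff)
  also have "\<dots> = (\<Sum>m\<le>n. smult (if i < m then h (real n - real m) else 0) (P (int n - int m)))"
    by (rule sum.mono_neutral_cong_left) auto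
  finally show ?thesis .
qed

text \<open>
Collect the coefficient of \<open>P (n - m)\<close> in \<open>X Q\<close>, where \<open>Q\<close> is the combination of
\<open>P n, \<dots>, P (n - k)\<close>. The partial sums contribute for every \<open>m \<ge> 1\<close>; for \<open>m > k\<close> their
contribution is a multiple of the full relation \<open>ann\<close> and disappears, and for \<open>m \<le> k\<close> the
hypothesis \<open>id\<close> corrects the eigenvalue \<open>u (n - m)\<close> to \<open>u n\<close>.
\<close>
lemma perturbed_operator_eigenvector:
  fixes P :: "int \<Rightarrow> real poly"
  assumes X: "X \<in> D_alg \<beta>" and neg: "\<And>j. j < 0 \<Longrightarrow> P j = 0"
    and XP: "\<And>n::nat. X (P (int n)) = smult (u (real n)) (P (int n))
        + (\<Sum>l<k. smult (f l (real n)) (\<Sum>j<n. smult (h l (real j)) (P (int j))))"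
    and ann: "\<And>l. l < k \<Longrightarrow> (\<Sum>i\<le>k. C i * f l (real n - real i)) = 0"
    and id: "\<And>m. m \<le> k \<Longrightarrow> (\<Sum>l<k. h l (real n - real m) * (\<Sum>i<m. C i * f l (real n - real i)))
        = C m * (u (real n) - u (real n - real m))"
  shows "X (\<Sum>i\<le>k. smult (C i) (P (int n - int i))) = smult (u (real n)) (\<Sum>i\<le>k. smult (C i) (P (int n - int i)))"
proof -
  let ?P = "\<lambda>i. P (int n - int i)" and ?x = "\<lambda>i. real n - real i"
  have X0: "X 0 = 0" using D_alg_linear(2)[OF X, of 0 0] by simp
  have XPi: "X (?P i) = smult (u (?x i)) (?P i)
     + (\<Sum>l<k. smult (f l (?x i)) (\<Sum>m\<le>n. smult (if i < m then h l (?x m) else 0) (?P m)))" for i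
  proof (cases "i \<le> n")
    case True
    then have "X (?P i) = smult (u (?x i)) (?P i)
     + (\<Sum>l<k. smult (f l (?x i)) (\<Sum>j<n - i. smult (h l (real j)) (P (int j))))"
      using XP[of "n - i"] by (simp add: of_nat_diff)
    moreover have "(\<Sum>j<n - i. smult (h l (real j)) (P (int j)))
        = (\<Sum>m\<le>n. smult (if i < m then h l (?x m) else 0) (?P m))" for l
      by (rule reindex_downwards[OF neg])
    ultimately show ?thesis by simp
  next
    case False
    then have "(if i < m then h l (?x m) else 0) = 0" if "m \<le> n" for l m using that by simp
    then have "(\<Sum>m\<le>n. smult (if i < m then h l (?x m) else 0) (?P m)) = 0" for l
      by (intro sum.neutral) simp
    then show ?thesis using False neg[of "int n - int i"] by (simp add: X0)
  qed
  define W where "W m = (\<Sum>l<k. h l (?x m) * (\<Sum>i\<le>k. if i < m then C i * f l (?x i) else 0))" for m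
  have W: "W m = (if m \<le> k then C m * (u (real n) - u (?x m)) else 0)" for m
  proof (cases "m \<le> k")
    case True
    have "(\<Sum>i\<le>k. if i < m then C i * f l (?x i) else 0) = (\<Sum>i<m. C i * f l (?x i))" for l
      using True by (intro sum.mono_neutral_cong_right) auto
    then show ?thesis using id[OF True] True by (simp add: W_def)
  next
    case False
    then have "(\<Sum>i\<le>k. if i < m then C i * f l (?x i) else 0) = (\<Sum>i\<le>k. C i * f l (?x i))" for l
      by (intro sum.cong) auto
    then show ?thesis using ann False by (simp add: W_def)
  qed
  have "(\<Sum>i\<le>k. smult (C i) (\<Sum>l<k. smult (f l (?x i)) (\<Sum>m\<le>n. smult (if i < m then h l (?x m) else 0) (?P m))))
      = (\<Sum>i\<le>k. \<Sum>m\<le>n. \<Sum>l<k. smult (h l (?x m) * (if i < m then C i * f l (?x i) else 0)) (?P m))"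
  proof (rule sum.cong[OF refl])
    fix i
    show "smult (C i) (\<Sum>l<k. smult (f l (?x i)) (\<Sum>m\<le>n. smult (if i < m then h l (?x m) else 0) (?P m)))
      = (\<Sum>m\<le>n. \<Sum>l<k. smult (h l (?x m) * (if i < m then C i * f l (?x i) else 0)) (?P m))"
      unfolding smult_sum_right smult_smult
      by (subst sum.swap) (intro sum.cong refl, auto simp: mult_ac)
  qed
  also have "\<dots> = (\<Sum>m\<le>n. smult (W m) (?P m))"
    unfolding W_def sum_distrib_left smult_sum
    by (subst sum.swap) (rule sum.cong[OF refl], rule sum.swap)
  also have "\<dots> = (\<Sum>m\<le>k. smult (C m * (u (real n) - u (?x m))) (?P m))"
  proof -
    have "(\<Sum>m\<le>n. smult (W m) (?P m)) = (\<Sum>m\<le>min n k. smult (C m * (u (real n) - u (?x m))) (?P m))"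
      by (rule sum.mono_neutral_cong_right) (auto simp: W)
    also have "\<dots> = (\<Sum>m\<le>k. smult (C m * (u (real n) - u (?x m))) (?P m))"
      by (rule sum.mono_neutral_left) (auto simp: neg)
    finally show ?thesis .
  qed
  finally have "X (\<Sum>i\<le>k. smult (C i) (?P i)) = (\<Sum>i\<le>k. smult (C i * u (?x i)) (?P i))
      + (\<Sum>m\<le>k. smult (C m * (u (real n) - u (?x m))) (?P m))"
    by (simp add: D_alg_sum[OF X] D_alg_linear(2)[OF X] XPi smult_add_right sum.distrib)
  also have "\<dots> = smult (u (real n)) (\<Sum>i\<le>k. smult (C i) (?P i))"
    by (simp add: sum.distrib[symmetric] smult_add_left[symmetric] smult_sum_right algebra_simps)
  finally show ?thesis .
qed

text \<open>
\<open>K l j\<close> is \<open>G (t + 1)\<close> times an entry of the inverse of the Casorati matrix; divisibility by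
the determinant is what makes it a polynomial. The reflection maps a window to a window in
reversed order. Hence the reflected \<open>K l j\<close> and \<open>- K l (k - 1 - j)\<close> solve the same linear
system, whose matrix is nonsingular, and they agree.
\<close>
lemma window_kernels:
  fixes f :: "nat \<Rightarrow> real poly"
  assumes det: "det (casorati k f) \<noteq> 0"
    and dvd: "(det (casorati k f) \<circ>\<^sub>p [:-1, 1:]) dvd G"
    and f: "\<And>l x. l < k \<Longrightarrow> poly (f l) (- x - S) = poly (f l) x"
    and G: "\<And>x. poly G (real k - x - S) = - poly G (x + 1)"
  obtains K :: "nat \<Rightarrow> nat \<Rightarrow> real poly"
  where "\<And>t j j'. j < k \<Longrightarrow> j' < k \<Longrightarrow>
      (\<Sum>l<k. poly (K l j) t * poly (f l) (t - real j')) = (if j = j' then poly G (t + 1) else 0)"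
    and "\<And>l j t. l < k \<Longrightarrow> j < k \<Longrightarrow> poly (K l j) (real k - 1 - t - S) = - poly (K l (k - 1 - j)) t"
proof -
  let ?M = "casorati k f"
  obtain g where g: "G = (det ?M \<circ>\<^sub>p [:-1, 1:]) * g" using dvd by (elim dvdE)
  define K where "K l j = (g \<circ>\<^sub>p [:1, 1:]) * cofactor ?M l j" for l j
  have 1: "(\<Sum>l<k. poly (K l j) t * poly (f l) (t - real j')) = (if j = j' then poly G (t + 1) else 0)"
    if "j < k" "j' < k" for t j j'
  proof -
    have "(\<Sum>l<k. poly (cofactor ?M l j) t * poly (f l) (t - real j'))
        = poly (\<Sum>l<k. cofactor ?M l j * ?M $$ (l, j')) t"
      using that(2) by (simp add: poly_sum casorati_index poly_pcompose)
    also have "\<dots> = (if j = j' then poly (det ?M) t else 0)"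
      by (simp add: sum_mult_cofactor_column[OF casorati_carrier that])
    finally show ?thesis
      by (simp add: K_def g poly_pcompose mult.assoc sum_distrib_left[symmetric] add.commute)
  qed
  have 2: "poly (K l j) (real k - 1 - t - S) = - poly (K l (k - 1 - j)) t" if lj: "l < k" "j < k" for l j t
  proof -
    define E where "E l = (K l j \<circ>\<^sub>p [:real k - 1 - S, -1:]) + K l (k - 1 - j)" for l
    have "E l = 0"
    proof (rule rows_independent_of_det_nonzero[OF casorati_carrier det _ lj(1)])
      fix j' assume j': "j' < k"
      show "(\<Sum>l<k. E l * ?M $$ (l, j')) = 0"
      proof (rule poly_eq_of_values)
        fix t
        let ?t = "real k - 1 - S - t"
        have refl: "poly (f l) (t - real j') = poly (f l) (?t - real (k - 1 - j'))" if "l < k" for l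
        proof -
          have e: "?t - real (k - 1 - j') = - (t - real j') - S" using j' by (simp add: of_nat_diff)
          show ?thesis unfolding e using f[OF that, of "t - real j'"] by simp
        qed
        have "poly (\<Sum>l<k. E l * ?M $$ (l, j')) t
           = (\<Sum>l<k. poly (K l j) ?t * poly (f l) (t - real j'))
             + (\<Sum>l<k. poly (K l (k - 1 - j)) t * poly (f l) (t - real j'))"
          using j' by (simp add: E_def poly_sum casorati_index poly_pcompose sum.distrib[symmetric] algebra_simps)
        also have "(\<Sum>l<k. poly (K l j) ?t * poly (f l) (t - real j'))
           = (if j = k - 1 - j' then poly G (?t + 1) else 0)"
          using 1[of j "k - 1 - j'" ?t] lj(2) j' by (simp add: refl)
        also have "poly G (?t + 1) = - poly G (t + 1)" using G[of t] by (simp add: algebra_simps)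
        also have "(\<Sum>l<k. poly (K l (k - 1 - j)) t * poly (f l) (t - real j'))
           = (if k - 1 - j = j' then poly G (t + 1) else 0)"
          using 1[of "k - 1 - j" j' t] lj(2) j' by simp
        finally show "poly (\<Sum>l<k. E l * ?M $$ (l, j')) t = poly 0 t"
          using lj(2) j' by (auto split: if_splits)
      qed
    qed
    then have "poly (E l) t = 0" by simp
    then show ?thesis by (simp add: E_def poly_pcompose algebra_simps)
  qed
  from that[OF 1 2] show thesis .
qed

section \<open>Construction of the operators\<close>

text \<open>
This is the expansion of the Wronskian along its last row. The cofactors annihilate each of
the other rows because replacing the last row by one of them gives a singular matrix.
\<close>
lemma q_expansion:
  fixes \<beta> :: real
  obtains C where "q \<alpha> \<beta> k a n = (\<Sum>i\<le>k. smult (C i) (jacobi (real \<alpha>) \<beta> (int n - int i)))"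
    and "\<And>l. l < k \<Longrightarrow> (\<Sum>i\<le>k. C i * poly (psi \<alpha> \<beta> a l) (real n - real i)) = 0"
    and "C 0 = (-1) ^ k * poly (tau \<alpha> \<beta> k a) (real n - 1)"
proof -
  let ?f = "\<lambda>l j. poly (psi \<alpha> \<beta> a l) (real n - real j)"
  \<comment> \<open>The last row of \<open>A\<close> is arbitrary, because the cofactors along that row do not see it.\<close>
  define A where "A = mat (Suc k) (Suc k) (\<lambda>(l, j). ?f l j)"
  define B where "B = mat (Suc k) (Suc k) (\<lambda>(l, j). if l = k then jacobi (real \<alpha>) \<beta> (int n - int j) else [:?f l j:])"
  have A: "A \<in> carrier_mat (Suc k) (Suc k)" and B: "B \<in> carrier_mat (Suc k) (Suc k)"
    by (simp_all add: A_def B_def)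
  interpret const: comm_ring_hom "\<lambda>x::real. [:x:]" by unfold_locales simp_all
  have "cofactor B k j = [:cofactor A k j:]" for j
  proof -
    have "mat_delete B k j = map_mat (\<lambda>x. [:x:]) (mat_delete A k j)"
      by (rule eq_matI) (auto simp: mat_delete_def A_def B_def)
    then have "det (mat_delete B k j) = [:det (mat_delete A k j):]" by simp
    moreover have "((-1) ^ (k + j) :: real poly) = [:(-1) ^ (k + j):]"
      by (intro poly_eq_of_values) (simp add: poly_power)
    ultimately show ?thesis by (simp add: cofactor_def)
  qed
  note cof = this
  have "q \<alpha> \<beta> k a n = det B"
    unfolding q_def Wr_def B_def
    by (rule arg_cong[where f = det]) (auto simp: nth_append less_Suc_eq)
  also have "\<dots> = (\<Sum>j<Suc k. B $$ (k, j) * cofactor B k j)"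
    by (rule laplace_expansion_row[OF B]) simp
  also have "\<dots> = (\<Sum>j\<le>k. smult (cofactor A k j) (jacobi (real \<alpha>) \<beta> (int n - int j)))"
    unfolding lessThan_Suc_atMost cof by (rule sum.cong) (auto simp: B_def)
  finally have 1: "q \<alpha> \<beta> k a n = \<dots>" .
  have 2: "(\<Sum>i\<le>k. cofactor A k i * ?f l i) = 0" if "l < k" for l
  proof -
    have "(\<Sum>i\<le>k. cofactor A k i * ?f l i) = (\<Sum>i<Suc k. A $$ (l, i) * cofactor A k i)"
      unfolding lessThan_Suc_atMost using that by (intro sum.cong) (auto simp: A_def)
    then show ?thesis using sum_mult_cofactor_row[OF A, of l k] that by simp
  qed
  have "mat_delete A k 0 = mat k k (\<lambda>(l, j). poly (psi \<alpha> \<beta> a l) (real n - 1 - real j))"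
    by (rule eq_matI) (auto simp: mat_delete_def A_def algebra_simps)
  then have 3: "cofactor A k 0 = (-1) ^ k * poly (tau \<alpha> \<beta> k a) (real n - 1)"
    by (simp add: cofactor_def tau_eq_det_casorati poly_det_casorati)
  show thesis by (rule that[OF 1 2 3])
qed

lemma q_degree:
  assumes \<beta>: "\<And>m::nat. 1 \<le> m \<Longrightarrow> \<beta> \<noteq> - real m"
    and tau: "poly (tau \<alpha> \<beta> k a) (real n - 1) \<noteq> 0"
  shows "degree (q \<alpha> \<beta> k a n) = n" and "q \<alpha> \<beta> k a n \<noteq> 0"
proof -
  obtain C where C: "q \<alpha> \<beta> k a n = (\<Sum>i\<le>k. smult (C i) (jacobi (real \<alpha>) \<beta> (int n - int i)))"
    "\<And>l. l < k \<Longrightarrow> (\<Sum>i\<le>k. C i * poly (psi \<alpha> \<beta> a l) (real n - real i)) = 0"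
    "C 0 = (-1) ^ k * poly (tau \<alpha> \<beta> k a) (real n - 1)" by (rule q_expansion[of \<alpha> \<beta> k a n]) blast
  have S: "real \<alpha> + \<beta> + 1 + real m \<noteq> 0" for m :: nat
  proof
    assume "real \<alpha> + \<beta> + 1 + real m = 0"
    with \<beta>[of "\<alpha> + 1 + m"] show False by simp
  qed
  note J = jacobi_degree[OF S \<beta>]
  have deg: "degree (jacobi (real \<alpha>) \<beta> (int n - int i)) \<le> n - i" for i
    using J(2)[of "n - i"] by (cases "i \<le> n") (auto simp: of_nat_diff jacobi_def)
  have "coeff (q \<alpha> \<beta> k a n) n = (\<Sum>i\<le>k. if i = 0 then C 0 * coeff (jacobi (real \<alpha>) \<beta> (int n)) n else 0)"
    unfolding C(1) coeff_sum
  proof (rule sum.cong[OF refl])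
    fix i
    have "coeff (jacobi (real \<alpha>) \<beta> (int n - int i)) n = 0" if "i > 0"
    proof (cases "i \<le> n")
      case True
      with deg[of i] that show ?thesis by (intro coeff_eq_0) simp
    next
      case False
      then show ?thesis by (simp add: jacobi_def)
    qed
    then show "coeff (smult (C i) (jacobi (real \<alpha>) \<beta> (int n - int i))) n
        = (if i = 0 then C 0 * coeff (jacobi (real \<alpha>) \<beta> (int n)) n else 0)" by simp
  qed
  then have nz: "coeff (q \<alpha> \<beta> k a n) n \<noteq> 0" using J(1)[of n] tau C(3) by simp
  moreover have "degree (q \<alpha> \<beta> k a n) \<le> n"
    unfolding C(1) by (intro degree_sum_le) (auto intro: order.trans[OF degree_smult_le] order.trans[OF deg])
  ultimately show "degree (q \<alpha> \<beta> k a n) = n" by (simp add: le_antisym le_degree)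
  show "q \<alpha> \<beta> k a n \<noteq> 0" using nz by auto
qed

lemma poly_lam: "poly (lam [:s:] [:c, 1:]) x = lam s (x + c)"
  by (simp add: lam_def) (simp add: algebra_simps)

text \<open>
Let \<open>U n\<close> be the desired eigenvalue and \<open>G n = U n - U (n - 1)\<close>. The weight \<open>H l\<close> at \<open>N\<close> is
minus the sum of the kernels of the \<open>k\<close> windows containing \<open>N\<close>. The reflection maps
these windows to the windows containing the mirror image of \<open>N\<close> and changes the sign of the
kernels, so \<open>H l\<close> is anti-invariant. Moreover
\<open>\<Sum>l<k. psi l * H l\<close> telescopes to \<open>U n - U (n + k)\<close>, and removing half of it from \<open>U\<close>
leaves the mean of \<open>U n\<close> and \<open>U (n + k)\<close>, which is invariant because the reflection
interchanges \<open>n - k / 2\<close> and \<open>n + k / 2\<close> in the argument of \<open>lam\<close>.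
\<close>
lemma bispectral_operator:
  assumes "0 < \<alpha>" "k \<le> \<alpha>" and \<beta>: "\<And>m::nat. 1 \<le> m \<Longrightarrow> \<beta> \<noteq> - real m"
    and A: "F \<in> A_alg \<alpha> \<beta> k a"
  shows "\<exists>B \<in> D_alg \<beta>. \<forall>n::nat. B (q \<alpha> \<beta> k a n)
     = smult (poly F (lam (real \<alpha> + \<beta>) (real n - real k / 2))) (q \<alpha> \<beta> k a n)"
proof -
  define S where "S = real \<alpha> + \<beta> + 1"
  let ?f = "psi \<alpha> \<beta> a"
  define U where "U = F \<circ>\<^sub>p lam [:real \<alpha> + \<beta>:] [:- (real k / 2), 1:]"
  define G where "G = U - F \<circ>\<^sub>p lam [:real \<alpha> + \<beta>:] [:- (real k / 2) - 1, 1:]"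
  have U: "poly U x = poly F (lam (real \<alpha> + \<beta>) (x - real k / 2))" for x
    by (simp add: U_def poly_pcompose poly_lam)
  have G: "poly G x = poly U x - poly U (x - 1)" for x
    unfolding U by (simp add: G_def U_def poly_pcompose poly_lam add_diff_eq diff_diff_eq add.commute)
  have lam_refl: "lam (real \<alpha> + \<beta>) (- x - S) = lam (real \<alpha> + \<beta>) x" for x
    by (simp add: lam_def S_def algebra_simps)
  have U_refl: "poly U (real k - x - S) = poly U x" for x
    using lam_refl[of "x - real k / 2"] by (simp add: U algebra_simps)
  have G_refl: "poly G (real k - x - S) = - poly G (x + 1)" for x
    using U_refl[of x] U_refl[of "x + 1"] by (simp add: G algebra_simps)
  have f_refl: "poly (?f l) (- x - S) = poly (?f l) x" for l x
    using psi_reflect by (simp add: S_def)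
  have det: "det (casorati k ?f) \<noteq> 0"
    using tau_nonzero[OF assms(1,2) \<beta>] by (simp add: tau_eq_det_casorati)
  have dvd: "(det (casorati k ?f) \<circ>\<^sub>p [:-1, 1:]) dvd G"
    using A by (simp add: A_alg_def tau_eq_det_casorati G_def U_def)
  obtain K where K: "\<And>t j j'. j < k \<Longrightarrow> j' < k \<Longrightarrow>
      (\<Sum>l<k. poly (K l j) t * poly (?f l) (t - real j')) = (if j = j' then poly G (t + 1) else 0)"
    and K_refl: "\<And>l j t. l < k \<Longrightarrow> j < k \<Longrightarrow> poly (K l j) (real k - 1 - t - S) = - poly (K l (k - 1 - j)) t"
    by (rule window_kernels[OF det dvd f_refl G_refl]) blast
  define H where "H l = - (\<Sum>j<k. K l j \<circ>\<^sub>p [:real j, 1:])" for l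
  have H: "poly (H l) x = - (\<Sum>j<k. poly (K l j) (x + real j))" for l x
    by (simp add: H_def poly_sum poly_pcompose add.commute)
  have H_refl: "poly (H l) (- x - S) = - poly (H l) x" if "l < k" for l x
  proof -
    have "(\<Sum>j<k. poly (K l j) (- x - S + real j)) = (\<Sum>j<k. - poly (K l (k - 1 - j)) (x + real (k - 1 - j)))"
    proof (rule sum.cong[OF refl])
      fix j assume "j \<in> {..<k}"
      then show "poly (K l j) (- x - S + real j) = - poly (K l (k - 1 - j)) (x + real (k - 1 - j))"
        using K_refl[OF that, of j "x + real (k - 1 - j)"] by (simp add: of_nat_diff algebra_simps)
    qed
    also have "\<dots> = (\<Sum>j<k. - poly (K l j) (x + real j))"
      using sum.nat_diff_reindex[of "\<lambda>j. - poly (K l j) (x + real j)" k] by simp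
    finally show ?thesis by (simp add: H sum_negf)
  qed
  define V where "V = smult (1/2) (U + U \<circ>\<^sub>p [:real k, 1:])"
  have V_refl: "poly V (- x - S) = poly V x" for x
    using U_refl[of "x + real k"] U_refl[of x] by (simp add: V_def poly_pcompose algebra_simps)
  have fH: "(\<Sum>l<k. poly (?f l) x * poly (H l) x) = poly U x - poly U (x + real k)" for x
  proof -
    have "(\<Sum>l<k. poly (?f l) x * poly (H l) x)
       = - (\<Sum>j<k. \<Sum>l<k. poly (K l j) (x + real j) * poly (?f l) (x + real j - real j))"
      by (simp add: H sum_distrib_left sum_negf mult.commute) (rule sum.swap)
    also have "\<dots> = - (\<Sum>j<k. poly U (x + real (Suc j)) - poly U (x + real j))"
      by (intro arg_cong[where f = uminus] sum.cong[OF refl], subst K) (simp_all add: G add_ac)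
    also have "(\<Sum>j<k. poly U (x + real (Suc j)) - poly U (x + real j)) = poly U (x + real k) - poly U x"
      using sum_lessThan_telescope[of "\<lambda>j. poly U (x + real j)" k] by simp
    finally show ?thesis by simp
  qed
  have UV: "poly U x = poly V x + (\<Sum>l<k. poly (?f l) x * poly (H l) x) / 2" for x
    unfolding fH by (simp add: V_def poly_pcompose field_simps)
  have "\<exists>X \<in> D_alg \<beta>. \<forall>n::nat. X (jacobi (real \<alpha>) \<beta> (int n))
     = smult (poly U (real n)) (jacobi (real \<alpha>) \<beta> (int n))
     + (\<Sum>l<k. smult (poly (?f l) (real n)) (\<Sum>j<n. smult (poly (H l) (real j)) (jacobi (real \<alpha>) \<beta> (int j))))"
    by (rule perturbed_operator_in_D_alg[of \<beta> k H "real \<alpha>" ?f V U, folded S_def])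
      (erule \<beta> H_refl | rule f_refl V_refl UV)+
  then obtain X where X: "X \<in> D_alg \<beta>" "\<And>n::nat. X (jacobi (real \<alpha>) \<beta> (int n))
     = smult (poly U (real n)) (jacobi (real \<alpha>) \<beta> (int n))
     + (\<Sum>l<k. smult (poly (?f l) (real n)) (\<Sum>j<n. smult (poly (H l) (real j)) (jacobi (real \<alpha>) \<beta> (int j))))"
    by blast
  have "X (q \<alpha> \<beta> k a n) = smult (poly U (real n)) (q \<alpha> \<beta> k a n)" for n :: nat
  proof -
    obtain C where C: "q \<alpha> \<beta> k a n = (\<Sum>i\<le>k. smult (C i) (jacobi (real \<alpha>) \<beta> (int n - int i)))"
      "\<And>l. l < k \<Longrightarrow> (\<Sum>i\<le>k. C i * poly (?f l) (real n - real i)) = 0" by (rule q_expansion[of \<alpha> \<beta> k a n]) blast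
    have id: "(\<Sum>l<k. poly (H l) (real n - real m) * (\<Sum>i<m. C i * poly (?f l) (real n - real i)))
        = C m * (poly U (real n) - poly U (real n - real m))" if "m \<le> k" for m
    proof -
      have "(\<Sum>r<m. poly G (real n - real r)) = poly U (real n) - poly U (real n - real m)"
        using sum_lessThan_telescope'[of "\<lambda>r. poly U (real n - real r)" m]
        by (simp add: G algebra_simps)
      with window_functional_identity[of k C "\<lambda>l. poly (?f l)" "real n" "\<lambda>l j. poly (K l j)" "poly G" m,
          OF C(2) K that]
      show ?thesis by (simp only: H)
    qed
    show ?thesis unfolding C(1)
      by (rule perturbed_operator_eigenvector[OF X(1) _ X(2) C(2) id]) (simp add: jacobi_def)
  qed
  with X(1) show ?thesis unfolding U by blast
qed

lemma spectrum_determines_poly: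
  assumes "\<And>n::nat. n \<ge> n0 \<Longrightarrow> poly F (lam s (real n - c)) = poly H (lam s (real n - c))"
  shows "F = (H :: real poly)"
proof -
  let ?l = "[:- c, 1:] * [:s + 1 - c, 1:]"
  have "(F - H) \<circ>\<^sub>p ?l = 0"
  proof (rule poly_zero_of_eventually_zero_on_nat)
    fix n assume n: "n \<ge> n0"
    have "poly ?l (real n) = lam s (real n - c)" by (simp add: lam_def algebra_simps)
    with assms[OF n] show "poly ((F - H) \<circ>\<^sub>p ?l) (real n) = 0" by (simp add: poly_pcompose)
  qed
  moreover have "degree ?l > 0" by (simp add: degree_mult_eq)
  ultimately have "F - H = 0" using pcompose_eq_0 by blast
  then show ?thesis by simp
qed

theorem theorem4p2:
  fixes \<alpha> k :: nat and \<beta> :: real and a :: "nat \<Rightarrow> real"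
  assumes "0 < \<alpha>" and "0 < k" and "k \<le> \<alpha>"
    and "\<And>m::nat. 1 \<le> m \<Longrightarrow> \<beta> \<noteq> - real m"
  shows "(\<forall>f \<in> A_alg \<alpha> \<beta> k a. \<exists>B \<in> D_alg \<beta>. \<forall>n::nat.
            B (q \<alpha> \<beta> k a n)
              = smult (poly f (lam (real \<alpha> + \<beta>) (real n - real k / 2))) (q \<alpha> \<beta> k a n)) \<and>
         (\<forall>B :: real poly \<Rightarrow> (real poly \<Rightarrow> real poly).
            (\<forall>f \<in> A_alg \<alpha> \<beta> k a. B f \<in> D_alg \<beta> \<and> (\<forall>n::nat.
               B f (q \<alpha> \<beta> k a n)
                 = smult (poly f (lam (real \<alpha> + \<beta>) (real n - real k / 2))) (q \<alpha> \<beta> k a n)))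
            \<longrightarrow> comm_subalgebra (B ` A_alg \<alpha> \<beta> k a) (D_alg \<beta>) \<and>
                algebra_iso B (A_alg \<alpha> \<beta> k a) (B ` A_alg \<alpha> \<beta> k a))"
proof (rule conjI)
  show "\<forall>f \<in> A_alg \<alpha> \<beta> k a. \<exists>B \<in> D_alg \<beta>. \<forall>n::nat.
            B (q \<alpha> \<beta> k a n)
              = smult (poly f (lam (real \<alpha> + \<beta>) (real n - real k / 2))) (q \<alpha> \<beta> k a n)"
    using bispectral_operator[OF assms(1,3,4)] by blast
next
  let ?Q = "q \<alpha> \<beta> k a" and ?A = "A_alg \<alpha> \<beta> k a"
  let ?e = "\<lambda>f n. poly f (lam (real \<alpha> + \<beta>) (real n - real k / 2))"
  have "tau \<alpha> \<beta> k a \<circ>\<^sub>p [:-1, 1:] \<noteq> 0"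
    using tau_nonzero[OF assms(1,3,4), of a] by (simp add: pcompose_eq_0_iff)
  then obtain n0 where "\<And>n::nat. n \<ge> n0 \<Longrightarrow> poly (tau \<alpha> \<beta> k a \<circ>\<^sub>p [:-1, 1:]) (real n) \<noteq> 0"
    using eventually_nonzero_on_nat by blast
  then have Q: "degree (?Q n) = n" "?Q n \<noteq> 0" if "n \<ge> n0" for n
    using q_degree[of \<beta> \<alpha> k a n, OF assms(4)] that by (simp_all add: poly_pcompose)
  \<comment> \<open>An operator is known from its eigenvalues on the \<open>q n\<close>, so every identity between
    the operators \<open>B f\<close> can be checked on the scalars \<open>f (lam (n - k / 2))\<close>.\<close>
  have uniq: "L = M" if "L \<in> D_alg \<beta>" "M \<in> D_alg \<beta>" "\<And>n. L (?Q n) = M (?Q n)" for L M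
  proof
    fix p
    have "L p - M p = 0"
      using Q that(3) by (intro D_alg_zero_of_kills_degree_sequence[OF D_alg_minus[OF that(1,2)], of n0 ?Q]) auto
    then show "L p = M p" by simp
  qed
  show "\<forall>B. (\<forall>f \<in> ?A. B f \<in> D_alg \<beta> \<and> (\<forall>n::nat. B f (?Q n) = smult (?e f n) (?Q n)))
            \<longrightarrow> comm_subalgebra (B ` ?A) (D_alg \<beta>) \<and> algebra_iso B ?A (B ` ?A)"
  proof (intro allI impI)
    fix B assume B: "\<forall>f \<in> ?A. B f \<in> D_alg \<beta> \<and> (\<forall>n::nat. B f (?Q n) = smult (?e f n) (?Q n))"
    note sub = A_alg_subalgebra
    have one: "B 1 = id"
      by (rule uniq) (use B sub(1) in \<open>auto simp: D_alg_id\<close>)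
    have add: "B (f + g) = (\<lambda>p. B f p + B g p)" if "f \<in> ?A" "g \<in> ?A" for f g
      by (rule uniq) (use B that sub(2)[OF that] in \<open>auto simp: D_alg_add smult_add_left\<close>)
    have scale: "B (smult c f) = (\<lambda>p. smult c (B f p))" if "f \<in> ?A" for c f
      by (rule uniq) (use B that sub(3)[OF that] in \<open>auto simp: D_alg_smult\<close>)
    have mult: "B (f * g) = B f \<circ> B g" if "f \<in> ?A" "g \<in> ?A" for f g
    proof (rule uniq)
      show "B (f * g) \<in> D_alg \<beta>" using B sub(4)[OF that] by blast
      show "B f \<circ> B g \<in> D_alg \<beta>" unfolding o_def by (rule D_alg_comp) (use B that in auto)
      show "B (f * g) (?Q n) = (B f \<circ> B g) (?Q n)" for n
        using B that sub(4)[OF that] by (simp add: D_alg_linear(2)[of "B f" \<beta>] mult.commute)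
    qed
    have inj: "inj_on B ?A"
    proof (rule inj_onI)
      fix f g assume fg: "f \<in> ?A" "g \<in> ?A" "B f = B g"
      show "f = g"
      proof (rule spectrum_determines_poly)
        fix n assume "n \<ge> n0"
        moreover have "smult (?e f n) (?Q n) = smult (?e g n) (?Q n)" using B fg by metis
        then have "smult (?e f n - ?e g n) (?Q n) = 0" by (simp add: smult_diff_left)
        ultimately show "?e f n = ?e g n" using Q(2)[of n] by simp
      qed
    qed
    have "comm_subalgebra (B ` ?A) (D_alg \<beta>)"
      unfolding comm_subalgebra_def
    proof (intro conjI)
      show "B ` ?A \<subseteq> D_alg \<beta>" using B by blast
      show "id \<in> B ` ?A" unfolding one[symmetric] by (rule imageI) (rule sub(1))
      show "\<forall>L\<in>B ` ?A. \<forall>M\<in>B ` ?A. (\<lambda>p. L p + M p) \<in> B ` ?A"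
      proof (intro ballI, elim imageE)
        fix L M f g assume "L = B f" "M = B g" and fg: "f \<in> ?A" "g \<in> ?A"
        then show "(\<lambda>p. L p + M p) \<in> B ` ?A" using add[OF fg, symmetric] sub(2)[OF fg] by simp
      qed
      show "\<forall>c. \<forall>L\<in>B ` ?A. (\<lambda>p. smult c (L p)) \<in> B ` ?A"
      proof (intro allI ballI, elim imageE)
        fix c L f assume "L = B f" and f: "f \<in> ?A"
        then show "(\<lambda>p. smult c (L p)) \<in> B ` ?A" using scale[OF f, of c, symmetric] sub(3)[OF f, of c] by simp
      qed
      show "\<forall>L\<in>B ` ?A. \<forall>M\<in>B ` ?A. L \<circ> M \<in> B ` ?A"
      proof (intro ballI, elim imageE)
        fix L M f g assume "L = B f" "M = B g" and fg: "f \<in> ?A" "g \<in> ?A"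
        then show "L \<circ> M \<in> B ` ?A" using mult[OF fg, symmetric] sub(4)[OF fg] by simp
      qed
      show "\<forall>L\<in>B ` ?A. \<forall>M\<in>B ` ?A. L \<circ> M = M \<circ> L"
      proof (intro ballI, elim imageE)
        fix L M f g assume "L = B f" "M = B g" and fg: "f \<in> ?A" "g \<in> ?A"
        then show "L \<circ> M = M \<circ> L" using mult[OF fg] mult[OF fg(2,1)] by (simp add: mult.commute)
      qed
    qed
    moreover have "algebra_iso B ?A (B ` ?A)"
      unfolding algebra_iso_def using inj one add scale mult by (simp add: inj_on_imp_bij_betw)
    ultimately show "comm_subalgebra (B ` ?A) (D_alg \<beta>) \<and> algebra_iso B ?A (B ` ?A)" ..
  qed
qed

end
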